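(* Let $-\infty \le a < b \le \infty$ and fix $t_0 \in (a,b)$. For $\lambda \in \mathbb{R}$ and $t\in(a,b)$ put $$e_\lambda(t) := \begin{cases} \dfrac{1 - \lambda (t-t_0) - e^{-\lambda (t-t_0)}}{\lambda^2} & \text{for } \lambda \neq 0,\\[2mm] -\dfrac{(t-t_0)^2}{2} & \text{for } \lambda = 0.\end{cases}$$ Then a function $\psi : (a,b) \to \mathbb{R}$ is negative definite if and only if there exist a positive measure $\mu$ on $\mathbb{R}$ and constants $c,d \in \mathbb{R}$ such that $$\psi(t) = c + d(t-t_0) + \int_{-\infty}^{\infty} e_\lambda(t)\, e^{-\lambda t_0}\, d\mu(\lambda) \qquad \text{for all } t \in (a,b).\qquad ( * )$$ In this case $c = \psi(t_0)$, $d = \psi'(t_0)$, and $\mu$ is uniquely determined by $-\psi'' = \mathcal{L}(\mu)$ on $(a,b)$. A positive measure $\mu$ on $\mathbb{R}$ occurs in a representation $( * )$ for some such $\psi$ if and only if its Laplace transform $\mathcal{L}(\mu)$ is finite on $(a,b)$.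
   Context: A function $f : (a,b) \to \mathbb{R}$ is called negative definite if the kernel $Q(x,y) = f\big(\frac{x+y}{2}\big)$ on $(a,b)\times(a,b)$ is negative definite, i.e. $\sum_{j,k=1}^n c_j \overline{c_k}\, Q(x_j,x_k) \le 0$ for all $n$, all $x_1,\dots,x_n \in (a,b)$ and all $c_1,\dots,c_n \in \mathbb{C}$ with $\sum_j c_j = 0$. The Laplace transform of a positive measure $\mu$ on $\mathbb{R}$ is $\mathcal{L}(\mu)(t) = \int_{\mathbb{R}} e^{-\lambda t}\, d\mu(\lambda) \in [0,\infty]$.
   Formalization: "Negative definite" is replaced by "continuous and negative definite": a discontinuous additive function satisfies the kernel condition (its form vanishes when the c_j sum to 0) but is not of form ( * ), since every function ( * ) is smooth. *)

theory Defs
  imports "HOL-Analysis.Analysis" "HOL-Library.Complex_Order"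
begin

text \<open>The order on the complex numbers is \<open>z \<le> w \<longleftrightarrow> Re z \<le> Re w \<and> Im z = Im w\<close>, so
  \<open>z \<le> 0\<close> says that \<open>z\<close> is real and nonpositive.  The points \<open>x 0, \<dots>, x (n - 1)\<close>
  need not be distinct.\<close>

definition negative_definite_kernel :: "'a set \<Rightarrow> ('a \<Rightarrow> 'a \<Rightarrow> complex) \<Rightarrow> bool" where
  "negative_definite_kernel X Q \<longleftrightarrow>
     (\<forall>(n::nat) (x::nat \<Rightarrow> 'a) (c::nat \<Rightarrow> complex).
        (\<forall>j<n. x j \<in> X) \<longrightarrow> (\<Sum>j<n. c j) = 0 \<longrightarrow>
        (\<Sum>j<n. \<Sum>k<n. c j * cnj (c k) * Q (x j) (x k)) \<le> 0)"

text \<open>A function \<open>(a,b) \<rightarrow> \<real>\<close> is represented by a total function of which only the values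
  on \<open>S = (a,b)\<close> matter.\<close>

definition negative_definite_on :: "real set \<Rightarrow> (real \<Rightarrow> real) \<Rightarrow> bool" where
  "negative_definite_on S f \<longleftrightarrow>
     negative_definite_kernel S (\<lambda>x y. complex_of_real (f ((x + y) / 2)))"

definition laplace_transform :: "real measure \<Rightarrow> real \<Rightarrow> ennreal" where
  "laplace_transform \<mu> t = (\<integral>\<^sup>+ l. ennreal (exp (- l * t)) \<partial>\<mu>)"

definition efun :: "real \<Rightarrow> real \<Rightarrow> real \<Rightarrow> real" where
  "efun t0 l t =
     (if l = 0 then - ((t - t0)\<^sup>2 / 2)
      else (1 - l * (t - t0) - exp (- l * (t - t0))) / l\<^sup>2)"

text \<open>The integrability clause is needed because the Bochner integral of a non-integrable
  function is \<open>0\<close> by convention.  The integrand is nonpositive, so the clause only says that its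
  integral, which always exists in \<open>[-\<infinity>,0]\<close>, is finite.\<close>

definition levy_khinchin_rep ::
  "real set \<Rightarrow> real \<Rightarrow> (real \<Rightarrow> real) \<Rightarrow> real \<Rightarrow> real \<Rightarrow> real measure \<Rightarrow> bool" where
  "levy_khinchin_rep S t0 \<psi> c d \<mu> \<longleftrightarrow>
     (\<forall>t\<in>S. integrable \<mu> (\<lambda>l. efun t0 l t * exp (- l * t0)) \<and>
             \<psi> t = c + d * (t - t0) + (\<integral>l. efun t0 l t * exp (- l * t0) \<partial>\<mu>))"

end

theory Submission
  imports Defs
    "HOL-Computational_Algebra.Fundamental_Theorem_Algebra"
    "HOL-Probability.Levy"
    "HOL-Complex_Analysis.Conformal_Mappings"
    "HOL-Real_Asymp.Real_Asymp"
begin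

text \<open>
  Existence of \<open>\<mu>\<close>.  On a uniform grid of step \<open>h\<close> the second differences of a negative definite
  function form a sequence whose Hankel matrix and shifted Hankel matrix are positive semidefinite.
  After a small perturbation that makes both matrices strictly positive, Gauss quadrature represents
  the second differences as moments of a finite measure on \<open>(0,\<infinity>)\<close>.  Substituting
  \<open>z = exp (- \<lambda> h)\<close> and rescaling the atoms turns this into an exact representation of the perturbed
  function on the grid.  The masses weighted with \<open>(2 cosh (\<lambda> s) - 2) / \<lambda>\<^sup>2\<close> are second differences of
  the function at distance \<open>s\<close>; comparing two values of \<open>s\<close> gives tightness, and Helly's selection
  theorem yields the representation on a symmetric interval as the dyadic grids get finer.

  Uniqueness of \<open>\<mu>\<close> follows from analytic continuation of the Laplace transform to a vertical strip
  and the uniqueness theorem for characteristic functions.  It also shows that the measures on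
  overlapping intervals coincide, so that the local representations fit together.

  Finiteness of \<open>\<L>(\<mu>)\<close> is read off from second differences as well: that of
  \<open>t \<mapsto> e\<^sub>\<lambda>(t) exp (- \<lambda> t\<^sub>0)\<close> with step \<open>h\<close> dominates \<open>h\<^sup>2 exp (- \<lambda> t)\<close> in absolute value.
\<close>

subsection \<open>Gauss quadrature for positive functionals on polynomials\<close>

text \<open>Continuity of \<open>\<psi>\<close> is a genuine hypothesis of the formal statement: for
  a discontinuous additive function \<open>A\<close> the kernel
  \<open>A ((x + y) / 2) = (A x + A y) / 2\<close> has vanishing form on coefficients of sum zero,
  yet \<open>A\<close> has no representation, since represented functions are differentiable.
  Continuity is what carries the limit from dyadic points to the whole interval.

  No derivative of \<open>\<psi>\<close> is available at the start, so \<open>- \<psi>''\<close> is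
  replaced by second differences. Positivity of the Hankel matrix gives real nodes and positive
  weights; positivity of the shifted one gives positive nodes, without which
  \<open>\<lambda> = - ln z / h\<close> would make no sense. Quadrature needs definite forms, hence
  the perturbation, whose size on the grid tends to 0.

  The measure sought may be infinite. Limits are therefore taken for finite measures weighted with
  \<open>cosh_kernel s\<close>, relative to which the kernels with \<open>|t - m| \<le> s\<close>
  are bounded. The weight for a larger distance dominates this one times an exponential of
  \<open>|\<lambda>|\<close>, so no mass escapes.\<close>

lemma map_poly_of_real_add:
  "map_poly of_real (p + q) = (map_poly of_real p + map_poly of_real q :: 'a :: {real_algebra_1, idom} poly)"
  by (simp add: poly_eq_iff coeff_map_poly)

lemma map_poly_of_real_mult:
  "map_poly of_real (p * q) = (map_poly of_real p * map_poly of_real q :: 'a :: {real_algebra_1, idom} poly)"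
  by (simp add: poly_eq_iff coeff_map_poly coeff_mult)

locale poly_functional =
  fixes L :: "real poly \<Rightarrow> real" and n :: nat
  assumes L_add: "L (p + q) = L p + L q"
    and L_smult: "L (smult c p) = c * L p"
    and L_square: "p \<noteq> 0 \<Longrightarrow> degree p < n \<Longrightarrow> L (p * p) > 0"
    and L_shift: "p \<noteq> 0 \<Longrightarrow> degree p < n \<Longrightarrow> L ([:0, 1:] * (p * p)) > 0"
begin

lemma L_zero: "L 0 = 0"
  using L_smult[of 0 0] by simp

lemma L_diff: "L (p - q) = L p - L q"
  using L_add[of p "smult (-1) q"] L_smult[of "-1" q] by simp

lemma L_sum: "L (\<Sum>i\<in>A. f i) = (\<Sum>i\<in>A. L (f i))"
  by (induction A rule: infinite_finite_induct) (simp_all add: L_zero L_add)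

text \<open>Gram-Schmidt for the form \<open>L (p * q)\<close>, which is definite in degrees below
  \<open>n\<close>. The induction keeps \<open>f\<close> arbitrary because the step also projects
  \<open>monom 1 k\<close>, which produces the monic orthogonal polynomial \<open>P\<close> of
  degree \<open>k\<close>.\<close>

lemma orthogonal_projection:
  "k \<le> n \<Longrightarrow> \<exists>r. (r = 0 \<or> degree r < k) \<and> (\<forall>q. degree q < k \<longrightarrow> L ((f - r) * q) = 0)"
proof (induction k arbitrary: f)
  case 0
  show ?case by (intro exI[of _ 0]) simp
next
  case (Suc k)
  then have kn: "k < n" by simp
  obtain r where r: "r = 0 \<or> degree r < k" "\<And>q. degree q < k \<Longrightarrow> L ((f - r) * q) = 0"
    using Suc.IH[of f] kn by (meson less_imp_le)
  obtain u where u: "u = 0 \<or> degree u < k"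
      "\<And>q. degree q < k \<Longrightarrow> L ((monom 1 k - u) * q) = 0"
    using Suc.IH[of "monom 1 k"] kn by (meson less_imp_le)
  define P where "P = monom 1 k - u"
  have coeff_u: "coeff u k = 0" using u(1) by (auto simp: coeff_eq_0)
  have "degree (monom (1::real) k - u) \<le> k"
    using u(1) by (intro degree_diff_le) (auto simp: degree_monom_eq)
  then have degP: "degree P \<le> k" by (simp add: P_def)
  have coeffP: "coeff P k = 1" by (simp add: P_def coeff_u)
  then have P0: "P \<noteq> 0" by auto
  have pos: "L (P * P) > 0" using L_square[OF P0] degP kn by simp
  \<comment> \<open>The Fourier coefficient of \<open>f - r\<close> along \<open>P\<close>. Any
    \<open>q\<close> of degree at most \<open>k\<close> splits into a multiple of \<open>P\<close>
    and a part of lower degree, to which both \<open>f - r\<close> and \<open>P\<close> are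
    orthogonal.\<close>
  define a where "a = L ((f - r) * P) / L (P * P)"
  define r' where "r' = r + smult a P"
  have "degree r' \<le> k" using r(1) degP
    by (auto simp: r'_def intro!: degree_add_le order.trans[OF degree_smult_le])
  moreover have "L ((f - r') * q) = 0" if q: "degree q < Suc k" for q
  proof -
    define b where "b = coeff q k"
    define q' where "q' = q - smult b P"
    have "degree q' \<le> k" using q degP
      by (auto simp: q'_def intro!: degree_diff_le order.trans[OF degree_smult_le])
    moreover have "coeff q' k = 0" by (simp add: q'_def b_def coeffP)
    ultimately have q': "q' = 0 \<or> degree q' < k"
      by (metis leading_coeff_0_iff nat_less_le)
    have e1: "L ((f - r) * q') = 0" using q' r(2) L_zero by auto
    have e2: "L (P * q') = 0" using q' u(2) L_zero by (auto simp: P_def)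
    have "q = q' + smult b P" by (simp add: q'_def)
    then have "(f - r') * q = (f - r) * q' + smult b ((f - r) * P) - smult a (P * q')
        - smult (a * b) (P * P)"
      by (simp add: r'_def algebra_simps smult_add_right smult_diff_right)
    then have "L ((f - r') * q) = b * L ((f - r) * P) - a * b * L (P * P)"
      by (simp add: L_add L_diff L_smult e1 e2)
    also have "\<dots> = 0" using pos by (simp add: a_def)
    finally show ?thesis .
  qed
  ultimately show ?case by (intro exI[of _ r']) auto
qed

section \<open>Zeros of the orthogonal polynomial\<close>

definition orthogonal_poly :: "real poly \<Rightarrow> bool" where
  "orthogonal_poly P \<longleftrightarrow> P \<noteq> 0 \<and> degree P = n \<and> (\<forall>q. degree q < n \<longrightarrow> L (P * q) = 0)"

lemma orthogonal_poly_exists: "\<exists>P. orthogonal_poly P"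
proof -
  obtain r where r: "r = 0 \<or> degree r < n" "\<And>q. degree q < n \<Longrightarrow> L ((monom 1 n - r) * q) = 0"
    using orthogonal_projection[of n "monom 1 n"] by auto
  define P where "P = monom 1 n - r"
  have coeff_r: "coeff r n = 0" using r(1) by (auto simp: coeff_eq_0)
  have "degree (monom (1::real) n - r) \<le> n"
    using r(1) by (intro degree_diff_le) (auto simp: degree_monom_eq)
  then have "degree P \<le> n" by (simp add: P_def)
  moreover have c: "coeff P n = 1" by (simp add: P_def coeff_r)
  ultimately have "degree P = n" by (simp add: le_antisym le_degree)
  moreover have "P \<noteq> 0" using c by auto
  ultimately show ?thesis using r(2) unfolding orthogonal_poly_def P_def by blast
qed

text \<open>A double real root (\<open>c = 0\<close>) and a pair of conjugate nonreal roots are excluded by the same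
  computation.\<close>

lemma orthogonal_poly_no_square_factor:
  assumes P: "orthogonal_poly P" and f: "P = f * r" and d: "degree f = 2"
    and f': "f = g * g + smult (c * c) 1" and g: "degree g = 1"
  shows False
proof -
  have P0: "P \<noteq> 0" and Pn: "degree P = n" using P by (auto simp: orthogonal_poly_def)
  have f0: "f \<noteq> 0" and r0: "r \<noteq> 0" using P0 f by auto
  have dr: "degree r + 2 = n" using Pn f d f0 r0 by (simp add: degree_mult_eq)
  have g0: "g \<noteq> 0" using g by auto
  have "L (P * r) = 0" using P dr by (auto simp: orthogonal_poly_def)
  moreover have "P * r = (g * r) * (g * r) + smult (c * c) (r * r)"
    by (simp add: f f' algebra_simps)
  ultimately have "L ((g * r) * (g * r)) + c * c * L (r * r) = 0"
    by (simp add: L_add L_smult)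
  moreover have "L ((g * r) * (g * r)) > 0"
    using g0 r0 g dr by (intro L_square) (auto simp: degree_mult_eq)
  moreover have "L (r * r) > 0" using r0 dr by (intro L_square) auto
  ultimately show False by (smt (verit) mult_nonneg_nonneg zero_le_square)
qed

lemma orthogonal_poly_no_double_root:
  assumes "orthogonal_poly P" shows "\<not> [:-z, 1:] * [:-z, 1:] dvd P"
proof
  assume "[:-z, 1:] * [:-z, 1:] dvd P"
  then obtain r where r: "P = ([:-z, 1:] * [:-z, 1:]) * r" by (auto elim: dvdE)
  show False
    by (rule orthogonal_poly_no_square_factor[OF assms r, of "[:-z, 1:]" 0])
       (simp_all add: degree_mult_eq)
qed

text \<open>A nonreal root \<open>w\<close> of a real polynomial brings its conjugate along, hence
  the real factor \<open>(x - Re w)^2 + (Im w)^2\<close>, which is of the excluded shape.\<close>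

lemma orthogonal_poly_roots_real:
  assumes P: "orthogonal_poly P" and w: "poly (map_poly complex_of_real P) w = 0"
  shows "Im w = 0"
proof (rule ccontr)
  assume im: "Im w \<noteq> 0"
  define f where "f = [:- Re w, 1:] * [:- Re w, 1:] + smult (Im w * Im w) 1"
  have f: "f = [:Re w * Re w + Im w * Im w, - 2 * Re w, 1:]"
    by (simp add: f_def one_pCons)
  have df: "degree f = 2" by (simp add: f)
  then have f0: "f \<noteq> 0" by auto
  have "degree (P mod f) < 2 \<or> P mod f = 0" using degree_mod_less[OF f0, of P] df by auto
  then obtain a b where ab: "P mod f = [:a, b:]"
    by (metis degree_0 degree_eq_zeroE degree_pCons_eq_if less_2_cases not_less_eq
        pCons_cases less_Suc_eq numeral_2_eq_2 zero_less_Suc)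
  have fw: "poly (map_poly complex_of_real f) w = 0"
    by (simp add: f map_poly_pCons complex_eq_iff algebra_simps)
  have "P = f * (P div f) + [:a, b:]" using ab by (metis mult_div_mod_eq)
  then have "map_poly complex_of_real P = map_poly complex_of_real f *
      map_poly complex_of_real (P div f) + map_poly complex_of_real [:a, b:]"
    by (metis map_poly_of_real_add map_poly_of_real_mult)
  then have "poly (map_poly complex_of_real [:a, b:]) w = 0"
    using w fw by simp
  then have "of_real a + w * of_real b = 0" by (simp add: map_poly_pCons)
  \<comment> \<open>The remainder modulo the quadratic is a real affine polynomial vanishing at the
    nonreal \<open>w\<close>: its imaginary part gives \<open>b = 0\<close>, then its real part
    \<open>a = 0\<close>.\<close>
  then have "a = 0 \<and> b = 0" using im by (auto simp: complex_eq_iff)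
  then have "P mod f = 0" using ab by simp
  then obtain r where "P = f * r" by (metis dvd_eq_mod_eq_0 dvdE)
  from orthogonal_poly_no_square_factor[OF P this df f_def] show False by simp
qed

text \<open>Split off one linear factor for each real root. A nonconstant cofactor would have a
  complex root, which is a root of \<open>P\<close>, hence real and already in \<open>Z\<close>; its
  linear factor would then divide \<open>P\<close> twice.\<close>

lemma orthogonal_poly_card_roots:
  assumes P: "orthogonal_poly P" shows "card {z. poly P z = 0} = n"
proof -
  define Z where "Z = {z. poly P z = 0}"
  have P0: "P \<noteq> 0" and Pn: "degree P = n" using P by (auto simp: orthogonal_poly_def)
  have finZ: "finite Z" unfolding Z_def by (rule poly_roots_finite[OF P0])
  have "(\<Prod>z\<in>A. [:-z, 1:]) dvd P" if "finite A" "A \<subseteq> Z" for A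
    using that
  proof (induction A)
    case (insert z A)
    then obtain R where R: "P = (\<Prod>z\<in>A. [:-z, 1:]) * R" by (auto elim: dvdE)
    have "poly P z = 0" using insert.prems by (auto simp: Z_def)
    moreover have "poly (\<Prod>z\<in>A. [:-z, 1:]) z \<noteq> 0"
      using insert.hyps by (auto simp: poly_prod)
    ultimately have "poly R z = 0" by (simp add: R)
    then have "[:-z, 1:] dvd R" by (simp add: poly_eq_0_iff_dvd)
    then have "(\<Prod>z\<in>A. [:-z, 1:]) * [:-z, 1:] dvd P" by (subst R) (rule mult_dvd_mono[OF dvd_refl])
    then show ?case using insert.hyps by (simp add: mult.commute del: mult_pCons_left mult_pCons_right)
  qed simp
  then obtain R where R: "P = (\<Prod>z\<in>Z. [:-z, 1:]) * R" using finZ by (metis dvdE order_refl)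
  have R0: "R \<noteq> 0" using P0 R by auto
  have "degree R = 0"
  proof (rule ccontr)
    assume "degree R \<noteq> 0"
    then have "\<not> constant (poly (map_poly complex_of_real R))"
      by (simp add: constant_degree degree_map_poly)
    then obtain w where w: "poly (map_poly complex_of_real R) w = 0"
      using Fundamental_Theorem_Algebra.fundamental_theorem_of_algebra by blast
    then have "poly (map_poly complex_of_real P) w = 0"
      by (subst R) (simp add: map_poly_of_real_mult)
    then have "Im w = 0" by (rule orthogonal_poly_roots_real[OF P])
    then obtain z where z: "w = of_real z" by (metis complex_is_Real_iff Reals_cases)
    have "of_real (poly R z) = poly (map_poly complex_of_real R) (of_real z)"
      by (induction R) (simp_all add: map_poly_pCons)
    then have Rz: "poly R z = 0" using w z by (metis of_real_eq_0_iff)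
    then have "z \<in> Z" by (subst Z_def, subst R) simp
    then have "[:-z, 1:] dvd (\<Prod>z\<in>Z. [:-z, 1:])" using finZ by (intro dvd_prodI) auto
    moreover have "[:-z, 1:] dvd R" using Rz by (simp add: poly_eq_0_iff_dvd)
    ultimately have "[:-z, 1:] * [:-z, 1:] dvd P" by (subst R) (rule mult_dvd_mono)
    then show False using orthogonal_poly_no_double_root[OF P] by blast
  qed
  moreover have "degree P = degree (\<Prod>z\<in>Z. [:-z, 1:]) + degree R"
    using P0 R by (subst R) (metis degree_mult_eq mult_not_zero)
  moreover have "degree (\<Prod>z\<in>Z. [:-z, 1:]) = card Z"
    by (subst degree_prod_eq_sum_degree) auto
  ultimately show ?thesis using Pn by (simp add: Z_def)
qed

text \<open>The nodes are the zeros of the orthogonal polynomial \<open>P\<close>, the weights are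
  the values of \<open>L\<close> on the Lagrange basis. Interpolation alone is exact below degree
  \<open>n\<close>; division by \<open>P\<close> doubles this, because the quotient has degree below
  \<open>n\<close> and is annihilated together with \<open>P\<close>.\<close>

theorem gauss_quadrature:
  "\<exists>Z w. finite Z \<and> (\<forall>z\<in>Z. z > 0 \<and> w z > 0) \<and>
     (\<forall>f. degree f < 2 * n \<longrightarrow> L f = (\<Sum>z\<in>Z. w z * poly f z))"
proof -
  obtain P where P: "orthogonal_poly P" using orthogonal_poly_exists by blast
  then have P0: "P \<noteq> 0" and Pn: "degree P = n" by (auto simp: orthogonal_poly_def)
  define Z where "Z = {z. poly P z = 0}"
  have finZ: "finite Z" unfolding Z_def by (rule poly_roots_finite[OF P0])
  have cardZ: "card Z = n" unfolding Z_def by (rule orthogonal_poly_card_roots[OF P])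
  define l where "l z = (\<Prod>y\<in>Z - {z}. smult (1 / (z - y)) [:-y, 1:])" for z
  have degl: "degree (l z) < n" if "z \<in> Z" for z
  proof -
    have "degree (l z) \<le> (\<Sum>y\<in>Z - {z}. degree (smult (1 / (z - y)) [:-y, 1:]))"
      unfolding l_def using finZ degree_prod_sum_le[of "Z - {z}", unfolded o_def] by blast
    also have "\<dots> \<le> (\<Sum>y\<in>Z - {z}. 1)"
      by (intro sum_mono) (auto)
    also have "\<dots> = n - 1" using that finZ cardZ by simp
    finally have "degree (l z) \<le> n - 1" .
    moreover have "n > 0" using that finZ cardZ by (metis card_gt_0_iff empty_iff)
    ultimately show ?thesis by simp
  qed
  have l_self: "poly (l z) z = 1" for z
  proof -
    have "poly (smult (1 / (z - y)) [:-y, 1:]) z = 1" if "y \<in> Z - {z}" for y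
    proof -
      have "poly (smult (1 / (z - y)) [:-y, 1:]) z = 1 / (z - y) * poly [:-y, 1:] z"
        by (rule poly_smult)
      also have "poly [:-y, 1:] z = z - y" by simp
      finally have "poly (smult (1 / (z - y)) [:-y, 1:]) z = 1 / (z - y) * (z - y)" .
      then show ?thesis using that by simp
    qed
    then show ?thesis unfolding l_def poly_prod by (intro prod.neutral) blast
  qed
  have l_other: "poly (l z) y = 0" if "y \<in> Z" "y \<noteq> z" for y z
    using that finZ by (auto simp: l_def poly_prod intro!: prod_zero bexI[of _ y])
  have quad: "L f = (\<Sum>z\<in>Z. L (l z) * poly f z)" if f: "degree f < 2 * n" for f
  proof -
    define r where "r = f mod P"
    define q where "q = f div P"
    have n0: "n > 0" using f by simp
    have fq: "f = P * q + r" unfolding q_def r_def by (metis mult_div_mod_eq)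
    have degr: "degree r < n"
      using degree_mod_less[OF P0, of f] n0 Pn by (auto simp: r_def)
    have degq: "degree q < n"
    proof (cases "q = 0")
      case False
      have "P * q = f - r" using fq by simp
      then have "n + degree q = degree (f - r)" using False P0 Pn by (metis degree_mult_eq)
      also have "\<dots> < 2 * n" using f degr by (intro le_less_trans[OF degree_diff_le_max]) auto
      finally show ?thesis by simp
    qed (use n0 in simp)
    have rz: "poly r z = poly f z" if "z \<in> Z" for z using that by (simp add: fq Z_def)
    have "r = (\<Sum>z\<in>Z. smult (poly f z) (l z))"
    proof (rule poly_eqI_degree[where A = Z])
      fix y assume y: "y \<in> Z"
      have "poly (\<Sum>z\<in>Z. smult (poly f z) (l z)) y = (\<Sum>z\<in>Z. poly f z * poly (l z) y)"
        by (simp add: poly_sum)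
      also have "\<dots> = (\<Sum>z\<in>Z. if z = y then poly f y else 0)"
        using y by (intro sum.cong) (auto simp: l_self l_other)
      finally show "poly r y = poly (\<Sum>z\<in>Z. smult (poly f z) (l z)) y"
        using y finZ by (simp add: rz)
    next
      show "degree r < card Z" using degr cardZ by simp
      show "degree (\<Sum>z\<in>Z. smult (poly f z) (l z)) < card Z"
        using degl cardZ n0 finZ by (intro degree_sum_less le_less_trans[OF degree_smult_le]) auto
    qed
    then have "L r = (\<Sum>z\<in>Z. L (l z) * poly f z)"
      by (simp add: L_sum L_smult mult.commute)
    moreover have "L (P * q) = 0" using P degq by (auto simp: orthogonal_poly_def)
    ultimately show ?thesis by (simp add: fq L_add)
  qed
  \<comment> \<open>Testing with \<open>l z * l z\<close>, of degree at most
    \<open>2 * n - 2\<close>, shows that the weight is positive. The extra factor \<open>x\<close>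
    leads to degree at most \<open>2 * n - 1\<close>, the last one with exactness, and yields the
    sign of the node.\<close>
  have "z > 0 \<and> L (l z) > 0" if z: "z \<in> Z" for z
  proof -
    have l0: "l z \<noteq> 0" using l_self[of z] by auto
    have pick: "(\<Sum>y\<in>Z. L (l y) * (g y * (poly (l z) y * poly (l z) y))) = L (l z) * g z" for g
    proof -
      have "(\<Sum>y\<in>Z. L (l y) * (g y * (poly (l z) y * poly (l z) y))) =
          (\<Sum>y\<in>Z. if y = z then L (l z) * g z else 0)"
        by (intro sum.cong) (auto simp: l_self l_other)
      then show ?thesis using z finZ by simp
    qed
    have "L (l z * l z) = L (l z)"
      using degl[OF z] l0 pick[of "\<lambda>_. 1"] by (subst quad) (auto simp: degree_mult_eq)
    then have pos: "L (l z) > 0" using L_square[OF l0 degl[OF z]] by simp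
    have "degree ([:0, 1:] * (l z * l z)) < 2 * n"
      using degl[OF z] l0 by (subst degree_mult_eq) (auto simp: degree_mult_eq)
    then have "L ([:0, 1:] * (l z * l z)) = L (l z) * z"
      using pick[of "\<lambda>y. y"] by (subst quad) auto
    then show ?thesis using L_shift[OF l0 degl[OF z]] pos by (simp add: zero_less_mult_iff)
  qed
  then show ?thesis using finZ quad by (intro exI[of _ Z] exI[of _ "\<lambda>z. L (l z)"]) auto
qed

end

subsection \<open>Exact representation on a finite grid\<close>

lemma exp_diff_ge: "(x::real) \<ge> 0 \<Longrightarrow> exp x - exp (- x) \<ge> 2 * x"
proof -
  assume x: "x \<ge> 0"
  have "(\<lambda>y::real. exp y - exp (- y) - 2 * y) 0 \<le> (\<lambda>y. exp y - exp (- y) - 2 * y) x"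
  proof (rule DERIV_nonneg_imp_nondecreasing[OF x])
    fix y :: real
    have "((\<lambda>y. exp y - exp (- y) - 2 * y) has_real_derivative (exp y + exp (- y) - 2)) (at y)"
      by (auto intro!: derivative_eq_intros)
    moreover have "exp y + exp (- y) - 2 = (exp (y / 2) - exp (- y / 2))\<^sup>2"
      by (simp add: power2_eq_square algebra_simps mult_exp_exp)
    ultimately show "\<exists>z. ((\<lambda>y. exp y - exp (- y) - 2 * y) has_real_derivative z) (at y) \<and> 0 \<le> z"
      by (metis zero_le_power2)
  qed
  then show ?thesis by simp
qed

text \<open>\<open>2 cosh x - 2\<close> is the square of \<open>2 sinh (x / 2)\<close>, so this is
  the preceding inequality squared.\<close>

lemma exp_plus_exp_minus_ge: "exp x + exp (- x) - 2 \<ge> (x::real)\<^sup>2"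
proof -
  have "(2 * \<bar>x / 2\<bar>)\<^sup>2 \<le> (exp \<bar>x / 2\<bar> - exp (- \<bar>x / 2\<bar>))\<^sup>2"
    using exp_diff_ge[of "\<bar>x / 2\<bar>"] by (intro power_mono) auto
  also have "\<dots> = (exp (x / 2) - exp (- x / 2))\<^sup>2"
    by (cases "x \<ge> 0") (auto simp: power2_commute)
  also have "\<dots> = exp x + exp (- x) - 2"
    by (simp add: power2_eq_square algebra_simps mult_exp_exp)
  finally show ?thesis by (simp add: power_mult_distrib)
qed

text \<open>Minus the second difference, with step \<open>h\<close>, of \<open>t \<mapsto> e\<^sub>l(t)\<close> at its base point.\<close>

definition cosh_kernel :: "real \<Rightarrow> real \<Rightarrow> real" where
  "cosh_kernel h l = (if l = 0 then h\<^sup>2 else (exp (l * h) + exp (- (l * h)) - 2) / l\<^sup>2)"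

text \<open>Uniformity in \<open>l\<close> is the point: it lets a second difference of fixed step
  dominate \<open>exp (- l * t)\<close> for all \<open>l\<close> at once.\<close>

lemma cosh_kernel_ge: "h\<^sup>2 \<le> cosh_kernel h l"
  using exp_plus_exp_minus_ge[of "l * h"]
  by (simp add: cosh_kernel_def field_simps power_mult_distrib)

lemma cosh_kernel_pos: "h \<noteq> 0 \<Longrightarrow> 0 < cosh_kernel h l"
  using cosh_kernel_ge[of h l] by (smt (verit) zero_less_power2)

text \<open>The affine part of the kernel cancels and a single exponential survives. Along an
  arithmetic progression of \<open>t\<close> it is a geometric sequence, which turns sums of kernels
  into moments.\<close>

lemma efun_second_difference:
  "efun m l (t + h) - 2 * efun m l t + efun m l (t - h) = - (exp (- l * (t - m)) * cosh_kernel h l)"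
proof (cases "l = 0")
  case True
  then show ?thesis by (simp add: efun_def cosh_kernel_def power2_eq_square field_simps)
next
  case False
  have "exp (- l * (t + h - m)) = exp (- l * (t - m)) * exp (- (l * h))"
       "exp (- l * (t - h - m)) = exp (- l * (t - m)) * exp (l * h)"
    by (simp_all add: exp_add [symmetric] algebra_simps)
  with False show ?thesis
    by (simp only: efun_def cosh_kernel_def if_False) (simp add: field_simps)
qed

section \<open>Hankel forms of second differences\<close>

lemma real_negative_definite_sum:
  fixes c x :: "nat \<Rightarrow> real"
  assumes "negative_definite_on S f" "\<And>j. j < n \<Longrightarrow> x j \<in> S" "(\<Sum>j<n. c j) = 0"
  shows "(\<Sum>j<n. \<Sum>k<n. c j * c k * f ((x j + x k) / 2)) \<le> 0"
proof -
  have "(\<Sum>j<n. complex_of_real (c j)) = 0"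
    using assms(3) by (simp flip: of_real_sum)
  then have "(\<Sum>j<n. \<Sum>k<n. complex_of_real (c j) * cnj (complex_of_real (c k)) *
      complex_of_real (f ((x j + x k) / 2))) \<le> 0"
    using assms(1,2) unfolding negative_definite_on_def negative_definite_kernel_def by blast
  moreover have "(\<Sum>j<n. \<Sum>k<n. complex_of_real (c j) * cnj (complex_of_real (c k)) *
      complex_of_real (f ((x j + x k) / 2))) =
      complex_of_real (\<Sum>j<n. \<Sum>k<n. c j * c k * f ((x j + x k) / 2))"
    by (simp only: of_real_sum of_real_mult complex_cnj_complex_of_real)
  ultimately have "complex_of_real (\<Sum>j<n. \<Sum>k<n. c j * c k * f ((x j + x k) / 2)) \<le> 0"
    by (simp only:)
  then show ?thesis unfolding less_eq_complex_def Re_complex_of_real by simp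
qed

lemma sum_lessThan_add:
  "(\<Sum>k<n + m. g k) = (\<Sum>k<n. g k) + (\<Sum>k<m. g (n + k :: nat) :: 'a :: comm_monoid_add)"
  by (induction m) (simp_all add: add.assoc)

text \<open>Use the points \<open>x j + h\<close> with coefficients \<open>c j\<close> and
  \<open>x j - h\<close> with \<open>- c j\<close>. These coefficients sum to zero for every
  \<open>c\<close>, and in the mixed pairs the shifts cancel, so the central value appears
  twice.\<close>

lemma second_difference_positive_definite:
  fixes c x :: "nat \<Rightarrow> real"
  assumes nd: "negative_definite_on S f"
    and x: "\<And>j. j < n \<Longrightarrow> x j + h \<in> S" "\<And>j. j < n \<Longrightarrow> x j - h \<in> S"
  shows "(\<Sum>i<n. \<Sum>j<n. c i * c j * (2 * f ((x i + x j) / 2) - f ((x i + x j) / 2 + h)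
           - f ((x i + x j) / 2 - h))) \<ge> 0"
proof -
  define y where "y k = (if k < n then x k + h else x (k - n) - h)" for k
  define b where "b k = (if k < n then c k else - c (k - n))" for k
  have "(\<Sum>j<n + n. b j) = 0" by (simp add: sum_lessThan_add b_def sum_negf)
  then have "(\<Sum>j<n + n. \<Sum>k<n + n. b j * b k * f ((y j + y k) / 2)) \<le> 0"
    using x by (intro real_negative_definite_sum[OF nd]) (auto simp: y_def)
  also have "(\<Sum>j<n + n. \<Sum>k<n + n. b j * b k * f ((y j + y k) / 2)) =
     - (\<Sum>i<n. \<Sum>j<n. c i * c j * (2 * f ((x i + x j) / 2) - f ((x i + x j) / 2 + h)
           - f ((x i + x j) / 2 - h)))"
  proof -
    have m: "(x i + h + (x j - h)) / 2 = (x i + x j) / 2" "(x i - h + (x j + h)) / 2 = (x i + x j) / 2"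
      "(x i + h + (x j + h)) / 2 = (x i + x j) / 2 + h" "(x i - h + (x j - h)) / 2 = (x i + x j) / 2 - h"
      for i j by (simp_all add: field_simps)
    have low: "b i = c i" "y i = x i + h" if "i < n" for i using that by (simp_all add: b_def y_def)
    have high: "b (n + i) = - c i" "y (n + i) = x i - h" for i by (simp_all add: b_def y_def)
    show ?thesis
      unfolding sum_lessThan_add sum.distrib[symmetric] sum_negf[symmetric]
      by (intro sum.cong refl) (simp only: low high m lessThan_iff, simp add: algebra_simps)
  qed
  finally show ?thesis by simp
qed

lemma affine_if_second_difference_zero:
  fixes g :: "nat \<Rightarrow> real"
  assumes "\<And>k. k + 2 \<le> N \<Longrightarrow> g (k + 2) - 2 * g (k + 1) + g k = 0" "k \<le> N"
  shows "g k = g 0 + real k * (g 1 - g 0)"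
  using assms(2)
proof (induction k rule: less_induct)
  case (less k)
  show ?case
  proof (cases "k < 2")
    case True then show ?thesis by (auto simp: less_2_cases_iff)
  next
    case False
    then obtain i where i: "k = i + 2" by (metis le_add_diff_inverse2 not_less)
    then show ?thesis
      using less.IH[of i] less.IH[of "i + 1"] less.prems assms(1)[of i] by (simp add: algebra_simps)
  qed
qed

lemma poly_eq_sum_lessThan:
  fixes p :: "'a :: comm_semiring_1 poly"
  assumes "degree p < n" shows "poly p z = (\<Sum>i<n. coeff p i * z ^ i)"
  unfolding poly_altdef using assms
  by (intro sum.mono_neutral_left) (auto simp: coeff_eq_0)

text \<open>The \<open>2 * n + 2\<close> grid points carry \<open>2 * n\<close> second differences,
  exactly as many monomials as an \<open>n\<close>-node Gauss rule integrates. With \<open>L\<close>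
  sending the \<open>i\<close>-th power to \<open>D i\<close>, the differences become moments;
  subtracting the matching exponential kernels from \<open>f\<close> leaves a function with
  vanishing second differences, which is affine on the grid.\<close>

lemma grid_representation_strict:
  fixes f :: "real \<Rightarrow> real" and A h m :: real and n :: nat
  defines "D \<equiv> \<lambda>j. 2 * f (A + real (j + 1) * h) - f (A + real (j + 2) * h) - f (A + real j * h)"
  assumes h: "h > 0"
    and pos: "\<And>p. p \<noteq> 0 \<Longrightarrow> degree p < n \<Longrightarrow> (\<Sum>i<n. \<Sum>j<n. coeff p i * coeff p j * D (i + j)) > 0"
      "\<And>p. p \<noteq> 0 \<Longrightarrow> degree p < n \<Longrightarrow> (\<Sum>i<n. \<Sum>j<n. coeff p i * coeff p j * D (i + j + 1)) > 0"
  shows "\<exists>\<Lambda> \<omega> c d. finite \<Lambda> \<and> (\<forall>l\<in>\<Lambda>. \<omega> l \<ge> 0) \<and> (\<forall>k\<le>2 * n + 1. f (A + real k * h) =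
           c + d * (A + real k * h - m) + (\<Sum>l\<in>\<Lambda>. \<omega> l * efun m l (A + real k * h)))"
proof -
  define L where "L p = (\<Sum>i\<le>degree p. coeff p i * D i)" for p
  have L: "L p = (\<Sum>i\<le>N. coeff p i * D i)" if "degree p \<le> N" for p N
    unfolding L_def using that by (intro sum.mono_neutral_left) (auto simp: coeff_eq_0)
  have add: "L (p + q) = L p + L q" for p q
  proof -
    have "degree (p + q) \<le> max (degree p) (degree q)" by (rule degree_add_le_max)
    then show ?thesis
      using L[of p "max (degree p) (degree q)"] L[of q "max (degree p) (degree q)"]
        L[of "p + q" "max (degree p) (degree q)"]
      by (simp add: algebra_simps sum.distrib)
  qed
  have smult: "L (smult c p) = c * L p" for c p
    using L[of "smult c p" "degree p"] by (simp add: degree_smult_le L_def sum_distrib_left mult.assoc)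
  have L0: "L 0 = 0" by (simp add: L_def)
  have Lsum: "L (\<Sum>i\<in>B. F i) = (\<Sum>i\<in>B. L (F i))" for F :: "nat \<Rightarrow> real poly" and B
    by (induction B rule: infinite_finite_induct) (simp_all add: L0 add)
  have Lmonom: "L (monom a i) = a * D i" for a i
  proof -
    have "L (monom a i) = (\<Sum>j\<le>i. coeff (monom a i) j * D j)"
      by (rule L) (rule degree_monom_le)
    also have "\<dots> = (\<Sum>j\<le>i. if j = i then a * D i else 0)" by (intro sum.cong) auto
    finally show ?thesis by simp
  qed
  have p_sum: "p = (\<Sum>i<n. monom (coeff p i) i)" if "degree p < n" for p :: "real poly"
    by (rule poly_eqI) (use that in \<open>auto simp: coeff_sum coeff_eq_0 not_less\<close>)
  have square: "p * p = (\<Sum>i<n. \<Sum>j<n. monom (coeff p i * coeff p j) (i + j))"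
    if "degree p < n" for p :: "real poly"
  proof -
    have "p * p = (\<Sum>i<n. monom (coeff p i) i) * (\<Sum>i<n. monom (coeff p i) i)"
      by (rule arg_cong2[OF p_sum p_sum]) (use that in auto)
    then show ?thesis by (simp add: sum_product mult_monom)
  qed
  interpret poly_functional L n
  proof
    fix p :: "real poly" assume p: "p \<noteq> 0" "degree p < n"
    show "L (p * p) > 0"
      using pos(1)[OF p] by (simp add: square[OF p(2)] Lsum Lmonom)
    have "[:0, 1:] * (p * p) = (\<Sum>i<n. \<Sum>j<n. monom (coeff p i * coeff p j) (i + j + 1))"
      by (simp add: square[OF p(2)] sum_distrib_left monom_Suc)
    then show "L ([:0, 1:] * (p * p)) > 0"
      using pos(2)[OF p] by (simp only: Lsum Lmonom)
  qed (rule add smult)+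
  obtain Z w where Z: "finite Z" "\<And>z. z \<in> Z \<Longrightarrow> z > 0 \<and> w z > 0"
    and quad: "\<And>f. degree f < 2 * n \<Longrightarrow> L f = (\<Sum>z\<in>Z. w z * poly f z)"
    using gauss_quadrature by auto
  have D: "D j = (\<Sum>z\<in>Z. w z * z ^ j)" if "j < 2 * n" for j
    using quad[of "monom 1 j"] Lmonom[of 1 j] that by (simp add: degree_monom_eq poly_monom)
  define lam where "lam z = - ln z / h" for z
  have inj: "inj_on lam Z"
    using h Z(2) by (auto simp: inj_on_def lam_def)
  \<comment> \<open>The divisor is minus the second difference of \<open>efun m l\<close> at the
    first interior grid point \<open>A + h\<close>, so the atom at \<open>lam z\<close> contributes
    exactly \<open>w z * z ^ k\<close> to the \<open>k\<close>-th difference.\<close>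
  define om where "om l = w (exp (- (l * h))) / (cosh_kernel h l * exp (- (l * (A + h - m))))" for l
  have z_lam: "exp (- (lam z * h)) = z" if "z \<in> Z" for z
    using h Z(2)[OF that] by (simp add: lam_def)
  define g where "g k = f (A + real k * h) - (\<Sum>l\<in>lam ` Z. om l * efun m l (A + real k * h))" for k
  have "g (k + 2) - 2 * g (k + 1) + g k = 0" if k: "k + 2 \<le> 2 * n + 1" for k
  proof -
    have e: "A + real (k + 2) * h = A + real (k + 1) * h + h" "A + real k * h = A + real (k + 1) * h - h"
      by (simp_all add: algebra_simps)
    define E where "E k l = efun m l (A + real k * h)" for k l
    have "(\<Sum>l\<in>lam ` Z. om l * (E (k + 2) l - 2 * E (k + 1) l + E k l)) =
        (\<Sum>l\<in>lam ` Z. om l * E (k + 2) l) - 2 * (\<Sum>l\<in>lam ` Z. om l * E (k + 1) l) +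
        (\<Sum>l\<in>lam ` Z. om l * E k l)"
      unfolding sum_distrib_left sum_subtractf[symmetric] sum.distrib[symmetric]
      by (intro sum.cong refl) (simp only: algebra_simps)
    then have "g (k + 2) - 2 * g (k + 1) + g k = - D k - (\<Sum>l\<in>lam ` Z. om l *
        (E (k + 2) l - 2 * E (k + 1) l + E k l))"
      unfolding g_def D_def E_def[symmetric]
      by (simp only:) (simp add: algebra_simps)
    also have "\<dots> = - D k - (\<Sum>l\<in>lam ` Z. om l *
        (efun m l (A + real (k + 1) * h + h) - 2 * efun m l (A + real (k + 1) * h) +
         efun m l (A + real (k + 1) * h - h)))"
      by (simp only: E_def e)
    also have "\<dots> = - D k + (\<Sum>l\<in>lam ` Z. om l * (exp (- l * (A + real (k + 1) * h - m)) * cosh_kernel h l))"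
      by (simp only: efun_second_difference) (simp add: sum_negf)
    also have "(\<Sum>l\<in>lam ` Z. om l * (exp (- l * (A + real (k + 1) * h - m)) * cosh_kernel h l)) =
       (\<Sum>z\<in>Z. w z * z ^ k)"
    proof (subst sum.reindex[OF inj], rule sum.cong)
      fix z assume z: "z \<in> Z"
      have "exp (- lam z * (A + real (k + 1) * h - m)) =
          exp (- (lam z * (A + h - m))) * exp (real k * (- (lam z * h)))"
        by (simp add: exp_add[symmetric] algebra_simps)
      also have "\<dots> = exp (- (lam z * (A + h - m))) * z ^ k"
        by (simp only: exp_of_nat_mult z_lam[OF z])
      finally show "((\<lambda>l. om l * (exp (- l * (A + real (k + 1) * h - m)) * cosh_kernel h l)) \<circ> lam) z
          = w z * z ^ k"
        using cosh_kernel_pos[of h "lam z"] h by (simp add: om_def z_lam[OF z])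
    qed simp
    finally show ?thesis using D[of k] k by simp
  qed
  then have g: "g k = g 0 + real k * (g 1 - g 0)" if "k \<le> 2 * n + 1" for k
    using affine_if_second_difference_zero[of "2 * n + 1" g k] that by blast
  show ?thesis
  proof (intro exI conjI allI impI ballI)
    show "finite (lam ` Z)" using Z(1) by simp
    show "om l \<ge> 0" if "l \<in> lam ` Z" for l
      using that Z(2) cosh_kernel_pos[of h l] h by (auto simp: om_def z_lam less_imp_le)
    show "f (A + real k * h) = (g 0 - (g 1 - g 0) / h * (A - m)) +
        ((g 1 - g 0) / h) * (A + real k * h - m) +
        (\<Sum>l\<in>lam ` Z. om l * efun m l (A + real k * h))" if "k \<le> 2 * n + 1" for k
    proof -
      have "g 1 - g 0 = (g 1 - g 0) / h * h" using h by simp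
      then have "g k = g 0 + real k * ((g 1 - g 0) / h * h)" using g[OF that] by metis
      then show ?thesis unfolding g_def[of k] by (simp only: algebra_simps)
    qed
  qed
qed

text \<open>After exchanging the sums the Hankel form is the sum of
  \<open>W i * (poly p (z i))^2\<close>.\<close>

lemma exponential_moments_positive_definite:
  fixes W z :: "nat \<Rightarrow> real" and p :: "real poly"
  assumes "\<And>i. i < n \<Longrightarrow> W i > 0" "inj_on z {..<n}" "p \<noteq> 0" "degree p < n"
  shows "(\<Sum>a<n. \<Sum>b<n. coeff p a * coeff p b * (\<Sum>i<n. W i * z i ^ (a + b))) > 0"
proof -
  have "(\<Sum>a<n. \<Sum>b<n. coeff p a * coeff p b * (\<Sum>i<n. W i * z i ^ (a + b))) =
      (\<Sum>a<n. \<Sum>b<n. \<Sum>i<n. W i * ((coeff p a * z i ^ a) * (coeff p b * z i ^ b)))"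
    unfolding sum_distrib_left by (intro sum.cong refl) (simp add: power_add algebra_simps)
  also have "\<dots> = (\<Sum>a<n. \<Sum>i<n. \<Sum>b<n. W i * ((coeff p a * z i ^ a) * (coeff p b * z i ^ b)))"
    by (intro sum.cong refl sum.swap)
  also have "\<dots> = (\<Sum>i<n. \<Sum>a<n. \<Sum>b<n. W i * ((coeff p a * z i ^ a) * (coeff p b * z i ^ b)))"
    by (rule sum.swap)
  also have "\<dots> = (\<Sum>i<n. W i * (poly p (z i) * poly p (z i)))"
    unfolding poly_eq_sum_lessThan[OF assms(4)] sum_product unfolding sum_distrib_left ..
  also have "\<dots> > 0"
  proof -
    have "\<exists>i<n. poly p (z i) \<noteq> 0"
    proof (rule ccontr)
      assume "\<not> ?thesis"
      then have "p = 0"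
        using assms by (intro poly_eqI_degree[of "z ` {..<n}"]) (auto simp: card_image)
      then show False using assms(3) by simp
    qed
    then obtain i where i: "i < n" "poly p (z i) \<noteq> 0" by blast
    then have "W i * (poly p (z i) * poly p (z i)) > 0"
      using assms(1) by (metis mult_pos_pos not_real_square_gt_zero)
    then show ?thesis
      using i assms(1)
      by (intro sum_pos2[of _ i]) (simp_all add: less_imp_le del: zero_le_mult_iff)
  qed
  finally show ?thesis .
qed

text \<open>The multiple of \<open>e\<^sub>0 + \<dots> + e\<^bsub>n-1\<^esub>\<close> makes the Hankel forms of the second differences strictly
  positive: \<open>n\<close> atoms cannot all be roots of a polynomial of degree less than \<open>n\<close>.\<close>

lemma grid_representation:
  fixes f :: "real \<Rightarrow> real" and A h m \<epsilon> :: real and n :: nat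
  assumes nd: "negative_definite_on S f" and h: "h > 0" and eps: "\<epsilon> > 0"
    and S: "\<And>k. k \<le> 2 * n + 1 \<Longrightarrow> A + real k * h \<in> S"
  shows "\<exists>\<Lambda> \<omega> c d. finite \<Lambda> \<and> (\<forall>l\<in>\<Lambda>. \<omega> l \<ge> 0) \<and> (\<forall>k\<le>2 * n + 1.
           f (A + real k * h) + \<epsilon> * (\<Sum>i<n. efun m (real i) (A + real k * h)) =
           c + d * (A + real k * h - m) + (\<Sum>l\<in>\<Lambda>. \<omega> l * efun m l (A + real k * h)))"
proof (rule grid_representation_strict[where f = "\<lambda>t. f t + \<epsilon> * (\<Sum>i<n. efun m (real i) t)", OF h])
  \<comment> \<open>Both Hankel forms are treated together: \<open>r = 0\<close> is the plain one
    and \<open>r = 1\<close> the shifted one. The shift multiplies the \<open>l\<close>-th moment by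
    \<open>z l\<close>, which is absorbed into the weight \<open>W l\<close>.\<close>
  have pos: "(\<Sum>i<n. \<Sum>j<n. coeff p i * coeff p j *
      (2 * (f (A + real (i + j + r + 1) * h) + \<epsilon> * (\<Sum>l<n. efun m (real l) (A + real (i + j + r + 1) * h))) -
       (f (A + real (i + j + r + 2) * h) + \<epsilon> * (\<Sum>l<n. efun m (real l) (A + real (i + j + r + 2) * h))) -
       (f (A + real (i + j + r) * h) + \<epsilon> * (\<Sum>l<n. efun m (real l) (A + real (i + j + r) * h))))) > 0"
    if p: "p \<noteq> 0" "degree p < n" and r: "r \<le> 1" for p r
  proof -
    define D where "D k = 2 * f (A + real (k + 1) * h) - f (A + real (k + 2) * h) - f (A + real k * h)" for k
    define W where "W l = exp (- real l * (A + h - m)) * exp (- real l * h) ^ r * cosh_kernel h (real l)" for l :: nat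
    define z where "z l = exp (- real l * h)" for l :: nat
    have summand: "2 * (f (A + real (k + r + 1) * h) + \<epsilon> * (\<Sum>i<n. efun m (real i) (A + real (k + r + 1) * h))) -
       (f (A + real (k + r + 2) * h) + \<epsilon> * (\<Sum>i<n. efun m (real i) (A + real (k + r + 2) * h))) -
       (f (A + real (k + r) * h) + \<epsilon> * (\<Sum>i<n. efun m (real i) (A + real (k + r) * h)))
       = D (k + r) + \<epsilon> * (\<Sum>i<n. W i * z i ^ k)" for k
    proof -
      have e: "A + real (k + r + 2) * h = A + real (k + r + 1) * h + h"
        "A + real (k + r) * h = A + real (k + r + 1) * h - h" by (simp_all add: algebra_simps)
      have "(\<Sum>i<n. efun m (real i) (A + real (k + r + 2) * h)) -
          2 * (\<Sum>i<n. efun m (real i) (A + real (k + r + 1) * h)) +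
          (\<Sum>i<n. efun m (real i) (A + real (k + r) * h)) =
          (\<Sum>i<n. - (exp (- real i * (A + real (k + r + 1) * h - m)) * cosh_kernel h (real i)))"
        unfolding e sum_distrib_left sum_subtractf[symmetric] sum.distrib[symmetric]
          efun_second_difference ..
      also have "\<dots> = - (\<Sum>i<n. W i * z i ^ k)"
        unfolding sum_negf
      proof (intro arg_cong[of _ _ uminus] sum.cong refl)
        fix i
        have "exp (- real i * (A + real (k + r + 1) * h - m)) =
            exp (- real i * (A + h - m)) * exp (real (k + r) * (- real i * h))"
          by (simp add: exp_add[symmetric] algebra_simps)
        also have "\<dots> = exp (- real i * (A + h - m)) * (exp (- real i * h) ^ r * z i ^ k)"
          by (simp only: exp_of_nat_mult z_def power_add mult.commute)
        finally show "exp (- real i * (A + real (k + r + 1) * h - m)) * cosh_kernel h (real i) = W i * z i ^ k"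
          by (simp add: W_def)
      qed
      finally have *: "(\<Sum>i<n. W i * z i ^ k) = 2 * (\<Sum>i<n. efun m (real i) (A + real (k + r + 1) * h)) -
          (\<Sum>i<n. efun m (real i) (A + real (k + r + 2) * h)) -
          (\<Sum>i<n. efun m (real i) (A + real (k + r) * h))" by linarith
      show ?thesis unfolding * D_def by (simp add: algebra_simps)
    qed
    have "(\<Sum>i<n. \<Sum>j<n. coeff p i * coeff p j * D (i + j + r)) \<ge> 0"
    proof -
      \<comment> \<open>Spacing \<open>2 * h\<close> lets the midpoints run through consecutive grid
        points, and the offset \<open>1 + r\<close> makes them the centres of
        \<open>D (i + j + r)\<close>. The points \<open>x j + h\<close> and \<open>x j - h\<close>
        have indices between \<open>0\<close> and \<open>2 * n + 1\<close>.\<close>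
      define x where "x i = A + real (2 * i + 1 + r) * h" for i
      have "(\<Sum>i<n. \<Sum>j<n. coeff p i * coeff p j * (2 * f ((x i + x j) / 2)
          - f ((x i + x j) / 2 + h) - f ((x i + x j) / 2 - h))) \<ge> 0"
      proof (rule second_difference_positive_definite[OF nd])
        fix j assume j: "j < n"
        have "x j + h = A + real (2 * j + 2 + r) * h" "x j - h = A + real (2 * j + r) * h"
          by (simp_all add: x_def algebra_simps)
        moreover have "2 * j + 2 + r \<le> 2 * n + 1" "2 * j + r \<le> 2 * n + 1" using j r by auto
        ultimately show "x j + h \<in> S" "x j - h \<in> S" using S by metis+
      qed
      moreover have "(x i + x j) / 2 = A + real (i + j + r + 1) * h"
        "(x i + x j) / 2 + h = A + real (i + j + r + 2) * h"
        "(x i + x j) / 2 - h = A + real (i + j + r) * h" for i j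
        by (simp_all add: x_def field_simps)
      ultimately show ?thesis by (simp only: D_def)
    qed
    moreover have "(\<Sum>i<n. \<Sum>j<n. coeff p i * coeff p j * (\<Sum>l<n. W l * z l ^ (i + j))) > 0"
      using h cosh_kernel_pos[of h] p
      by (intro exponential_moments_positive_definite) (auto simp: W_def z_def inj_on_def)
    ultimately have "(\<Sum>i<n. \<Sum>j<n. coeff p i * coeff p j * D (i + j + r)) +
        \<epsilon> * (\<Sum>i<n. \<Sum>j<n. coeff p i * coeff p j * (\<Sum>l<n. W l * z l ^ (i + j))) > 0"
      using eps by (intro add_nonneg_pos mult_pos_pos)
    also have "(\<Sum>i<n. \<Sum>j<n. coeff p i * coeff p j * D (i + j + r)) +
        \<epsilon> * (\<Sum>i<n. \<Sum>j<n. coeff p i * coeff p j * (\<Sum>l<n. W l * z l ^ (i + j))) =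
        (\<Sum>i<n. \<Sum>j<n. coeff p i * coeff p j * (D (i + j + r) + \<epsilon> * (\<Sum>l<n. W l * z l ^ (i + j))))"
      unfolding sum_distrib_left[of \<epsilon>] sum.distrib[symmetric]
      by (intro sum.cong refl) (simp add: algebra_simps sum_distrib_left)
    finally show ?thesis unfolding summand .
  qed
  fix p :: "real poly" assume "p \<noteq> 0" "degree p < n"
  from pos[OF this, of 0] pos[OF this, of 1]
  show "(\<Sum>i<n. \<Sum>j<n. coeff p i * coeff p j *
      (2 * (f (A + real (i + j + 1) * h) + \<epsilon> * (\<Sum>l<n. efun m (real l) (A + real (i + j + 1) * h))) -
       (f (A + real (i + j + 2) * h) + \<epsilon> * (\<Sum>l<n. efun m (real l) (A + real (i + j + 2) * h))) -
       (f (A + real (i + j) * h) + \<epsilon> * (\<Sum>l<n. efun m (real l) (A + real (i + j) * h))))) > 0"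
   "(\<Sum>i<n. \<Sum>j<n. coeff p i * coeff p j *
      (2 * (f (A + real (i + j + 1 + 1) * h) + \<epsilon> * (\<Sum>l<n. efun m (real l) (A + real (i + j + 1 + 1) * h))) -
       (f (A + real (i + j + 1 + 2) * h) + \<epsilon> * (\<Sum>l<n. efun m (real l) (A + real (i + j + 1 + 2) * h))) -
       (f (A + real (i + j + 1) * h) + \<epsilon> * (\<Sum>l<n. efun m (real l) (A + real (i + j + 1) * h))))) > 0"
    by (simp_all only: add_0_right order_refl zero_le_one simp_thms)
qed

subsection \<open>Laplace transforms\<close>

text \<open>Dominated convergence for difference quotients: the mean value inequality on the ball
  bounds them by \<open>w\<close>. Stated over a normed field so that it serves a real
  \<open>t\<close> and the complex Laplace variable alike.\<close>

lemma has_field_derivative_integral: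
  fixes f f' :: "'a::{real_normed_field, banach, second_countable_topology} \<Rightarrow> 'b \<Rightarrow> 'a"
  assumes r: "r > 0"
    and deriv: "\<And>z x. z \<in> ball z0 r \<Longrightarrow> x \<in> space M \<Longrightarrow> ((\<lambda>z. f z x) has_field_derivative f' z x) (at z)"
    and int: "\<And>z. z \<in> ball z0 r \<Longrightarrow> integrable M (f z)"
    and meas: "f' z0 \<in> borel_measurable M"
    and bound: "\<And>z x. z \<in> ball z0 r \<Longrightarrow> x \<in> space M \<Longrightarrow> norm (f' z x) \<le> w x"
    and w: "integrable M w"
  shows "((\<lambda>z. \<integral>x. f z x \<partial>M) has_field_derivative (\<integral>x. f' z0 x \<partial>M)) (at z0)"
  unfolding has_field_derivative_iff tendsto_at_iff_sequentially
proof (intro allI impI)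
  fix X assume X: "\<forall>i. X i \<in> UNIV - {z0}" "X \<longlonglongrightarrow> z0"
  then obtain N where N: "\<And>n. n \<ge> N \<Longrightarrow> X n \<in> ball z0 r"
    using r unfolding tendsto_iff eventually_sequentially by (metis dist_commute mem_ball)
  define Y where "Y n = X (n + N)" for n
  have Y: "Y n \<in> ball z0 r" "Y n \<noteq> z0" for n using N X(1) by (auto simp: Y_def)
  have Ylim: "Y \<longlonglongrightarrow> z0" unfolding Y_def using X(2) by (rule LIMSEQ_ignore_initial_segment)
  have z0: "z0 \<in> ball z0 r" using r by simp
  have "(\<lambda>n. \<integral>x. (f (Y n) x - f z0 x) / (Y n - z0) \<partial>M) \<longlonglongrightarrow> (\<integral>x. f' z0 x \<partial>M)"
  proof (rule integral_dominated_convergence[OF meas _ w])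
    show "(\<lambda>x. (f (Y n) x - f z0 x) / (Y n - z0)) \<in> borel_measurable M" for n
      using int[OF Y(1)] int[OF z0]
      by (intro borel_measurable_divide borel_measurable_diff borel_measurable_const)
         (auto dest: borel_measurable_integrable)
    show "AE x in M. (\<lambda>n. (f (Y n) x - f z0 x) / (Y n - z0)) \<longlonglongrightarrow> f' z0 x"
    proof (rule AE_I2)
      fix x assume "x \<in> space M"
      from deriv[OF z0 this] show "(\<lambda>n. (f (Y n) x - f z0 x) / (Y n - z0)) \<longlonglongrightarrow> f' z0 x"
        unfolding has_field_derivative_iff tendsto_at_iff_sequentially comp_def
        using Y(2) Ylim by auto
    qed
    show "AE x in M. norm ((f (Y n) x - f z0 x) / (Y n - z0)) \<le> w x" for n
    proof (rule AE_I2)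
      fix x assume x: "x \<in> space M"
      have "norm (f (Y n) x - f z0 x) \<le> w x * norm (Y n - z0)"
        by (rule field_differentiable_bound[of "ball z0 r" "\<lambda>z. f z x" "\<lambda>z. f' z x"])
           (use deriv[OF _ x] bound[OF _ x] Y z0 in \<open>auto intro: has_field_derivative_at_within\<close>)
      then show "norm ((f (Y n) x - f z0 x) / (Y n - z0)) \<le> w x"
        using Y(2)[of n] by (simp add: norm_divide divide_le_eq)
    qed
  qed
  moreover have "(\<integral>x. (f (Y n) x - f z0 x) / (Y n - z0) \<partial>M) =
      ((\<integral>x. f (Y n) x \<partial>M) - (\<integral>x. f z0 x \<partial>M)) / (Y n - z0)" for n
    using int[OF Y(1)] int[OF z0] by simp
  ultimately have "(\<lambda>n. ((\<integral>x. f (Y n) x \<partial>M) - (\<integral>x. f z0 x \<partial>M)) / (Y n - z0)) \<longlonglongrightarrow> (\<integral>x. f' z0 x \<partial>M)"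
    by (simp only:)
  then show "((\<lambda>y. ((\<integral>x. f y x \<partial>M) - (\<integral>x. f z0 x \<partial>M)) / (y - z0)) \<circ> X) \<longlonglongrightarrow> (\<integral>x. f' z0 x \<partial>M)"
    unfolding Y_def by (simp add: o_def) (rule LIMSEQ_offset)
qed

lemma exp_le_endpoints:
  fixes l :: real assumes "u \<in> {\<alpha>..\<beta>}"
  shows "exp (- l * u) \<le> exp (- l * \<alpha>) + exp (- l * \<beta>)"
proof (cases "l \<ge> 0")
  case True
  then have "exp (- l * u) \<le> exp (- l * \<alpha>)" using assms by (auto intro: mult_left_mono)
  then show ?thesis by (smt (verit) exp_gt_zero)
next
  case False
  then have "exp (- l * u) \<le> exp (- l * \<beta>)" using assms by (auto intro: mult_left_mono_neg)
  then show ?thesis by (smt (verit) exp_gt_zero)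
qed

text \<open>A factor \<open>|l|\<close> produced by differentiation is paid for by
  \<open>\<delta> |l| \<le> exp (\<delta> |l|)\<close>. This costs a margin \<open>\<delta>\<close>
  on each side, beyond the \<open>\<delta>\<close> by which \<open>u\<close> itself may differ from
  \<open>t\<close>.\<close>

lemma abs_mult_exp_le_endpoints:
  fixes l :: real assumes "\<delta> > 0" "u \<in> {t - \<delta>..t + \<delta>}"
  shows "\<bar>l\<bar> * exp (- l * u) \<le> 2 / \<delta> * (exp (- l * (t - 2 * \<delta>)) + exp (- l * (t + 2 * \<delta>)))"
proof -
  have "\<delta> * \<bar>l\<bar> \<le> exp (\<delta> * \<bar>l\<bar>)" using exp_ge_add_one_self[of "\<delta> * \<bar>l\<bar>"] by linarith
  also have "\<dots> \<le> exp (- l * \<delta>) + exp (l * \<delta>)"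
    by (cases "l \<ge> 0") (auto simp: mult.commute)
  finally have "\<delta> * \<bar>l\<bar> * exp (- l * u) \<le> (exp (- l * \<delta>) + exp (l * \<delta>)) * exp (- l * u)"
    by (rule mult_right_mono) simp
  also have "\<dots> = exp (- l * (u + \<delta>)) + exp (- l * (u - \<delta>))"
    by (simp add: exp_add[symmetric] algebra_simps)
  also have "\<dots> \<le> 2 * (exp (- l * (t - 2 * \<delta>)) + exp (- l * (t + 2 * \<delta>)))"
    using exp_le_endpoints[of "u + \<delta>" "t - 2 * \<delta>" "t + 2 * \<delta>" l]
      exp_le_endpoints[of "u - \<delta>" "t - 2 * \<delta>" "t + 2 * \<delta>" l] assms by auto
  finally show ?thesis using assms(1) by (simp add: field_simps)
qed

lemma laplace_transform_finite_iff:
  assumes "sets \<mu> = sets borel"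
  shows "laplace_transform \<mu> t < \<infinity> \<longleftrightarrow> integrable \<mu> (\<lambda>l. exp (- l * t))"
proof -
  have [measurable_cong]: "sets \<mu> = sets borel" by fact
  have "(\<lambda>l::real. exp (- l * t)) \<in> borel_measurable \<mu>" by measurable
  then show ?thesis by (simp add: laplace_transform_def integrable_iff_bounded)
qed

lemma laplace_transform_eq_integral:
  assumes "sets \<mu> = sets borel" "integrable \<mu> (\<lambda>l. exp (- l * t))"
  shows "laplace_transform \<mu> t = ennreal (\<integral>l. exp (- l * t) \<partial>\<mu>)"
  unfolding laplace_transform_def using assms(2) by (intro nn_integral_eq_integral) auto

lemma interval_in_open:
  fixes t :: real assumes "open S" "t \<in> S"
  obtains \<delta> where "\<delta> > 0" "{t - 2 * \<delta>..t + 2 * \<delta>} \<subseteq> S"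
proof -
  obtain e where e: "e > 0" "cball t e \<subseteq> S" using assms open_contains_cball by blast
  then show ?thesis by (intro that[of "e / 2"]) (auto simp: cball_eq_atLeastAtMost)
qed

lemma complex_laplace_has_derivative:
  assumes sets: "sets \<mu> = sets borel" and S: "open S"
    and int: "\<And>t. t \<in> S \<Longrightarrow> integrable \<mu> (\<lambda>l. exp (- l * t))" and z: "Re z \<in> S"
  shows "((\<lambda>z. \<integral>l. exp (- complex_of_real l * z) \<partial>\<mu>) has_field_derivative
     (\<integral>l. - complex_of_real l * exp (- complex_of_real l * z) \<partial>\<mu>)) (at z)"
proof -
  have [measurable_cong]: "sets \<mu> = sets borel" by fact
  obtain \<delta> where \<delta>: "\<delta> > 0" "{Re z - 2 * \<delta>..Re z + 2 * \<delta>} \<subseteq> S"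
    using interval_in_open[OF S z] by blast
  have near: "Re y \<in> {Re z - \<delta>..Re z + \<delta>}" if "y \<in> ball z \<delta>" for y
    using that abs_Re_le_cmod[of "y - z"] by (auto simp: dist_norm norm_minus_commute)
  show ?thesis
  proof (rule has_field_derivative_integral[OF \<delta>(1)])
    show "integrable \<mu> (\<lambda>l. 2 / \<delta> * (exp (- l * (Re z - 2 * \<delta>)) + exp (- l * (Re z + 2 * \<delta>))))"
      using \<delta> by (intro integrable_mult_right Bochner_Integration.integrable_add int) auto
    show "(\<lambda>l. - complex_of_real l * exp (- complex_of_real l * z)) \<in> borel_measurable \<mu>"
      by measurable
    fix y assume y: "y \<in> ball z \<delta>"
    have "integrable \<mu> (\<lambda>l. exp (- l * Re y))"
      using near[OF y] \<delta> by (intro int) auto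
    then show "integrable \<mu> (\<lambda>l. exp (- complex_of_real l * y))"
      by (rule Bochner_Integration.integrable_bound) (auto)
    fix l
    show "((\<lambda>z. exp (- complex_of_real l * z)) has_field_derivative
        - complex_of_real l * exp (- complex_of_real l * y)) (at y)"
      by (auto intro!: derivative_eq_intros)
    show "norm (- complex_of_real l * exp (- complex_of_real l * y)) \<le>
        2 / \<delta> * (exp (- l * (Re z - 2 * \<delta>)) + exp (- l * (Re z + 2 * \<delta>)))"
      using abs_mult_exp_le_endpoints[OF \<delta>(1) near[OF y], of l] by (simp add: norm_mult)
  qed
qed

text \<open>The measures may be infinite, so characteristic functions are not directly available.
  Tilting by \<open>exp (- l * t1)\<close> and dividing by the common mass \<open>m\<close> gives
  probability measures; their characteristic functions are, up to \<open>m\<close>, the continued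
  transforms on the line \<open>Re z = t1\<close>. The tilt is invertible, so equality passes
  back.\<close>

lemma laplace_uniqueness:
  fixes \<mu> \<nu> :: "real measure"
  assumes sets: "sets \<mu> = sets borel" "sets \<nu> = sets borel"
    and I: "\<alpha> < \<beta>"
    and int: "\<And>t. t \<in> {\<alpha><..<\<beta>} \<Longrightarrow> integrable \<mu> (\<lambda>l. exp (- l * t))"
      "\<And>t. t \<in> {\<alpha><..<\<beta>} \<Longrightarrow> integrable \<nu> (\<lambda>l. exp (- l * t))"
    and eq: "\<And>t. t \<in> {\<alpha><..<\<beta>} \<Longrightarrow> (\<integral>l. exp (- l * t) \<partial>\<mu>) = (\<integral>l. exp (- l * t) \<partial>\<nu>)"
  shows "\<mu> = \<nu>"
proof -
  have [measurable_cong]: "sets \<mu> = sets borel" "sets \<nu> = sets borel" by fact+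
  define F where "F \<mu> z = (\<integral>l. exp (- complex_of_real l * z) \<partial>\<mu>)" for \<mu> and z :: complex
  define t1 where "t1 = (\<alpha> + \<beta>) / 2"
  have t1: "t1 \<in> {\<alpha><..<\<beta>}" using I by (simp add: t1_def)
  have F_real: "F \<mu> (of_real t) = of_real (\<integral>l. exp (- l * t) \<partial>\<mu>)" for \<mu> t
    unfolding F_def by (simp flip: integral_complex_of_real add: exp_of_real [symmetric])
  have hol: "F M holomorphic_on {z. Re z \<in> {\<alpha><..<\<beta>}}"
    if M: "sets M = sets borel" "\<And>t. t \<in> {\<alpha><..<\<beta>} \<Longrightarrow> integrable M (\<lambda>l. exp (- l * t))" for M
  proof -
    have "(F M has_field_derivative (\<integral>l. - complex_of_real l * exp (- complex_of_real l * z) \<partial>M)) (at z)"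
      if "Re z \<in> {\<alpha><..<\<beta>}" for z
      unfolding F_def[abs_def]
      by (rule complex_laplace_has_derivative[OF M(1) open_greaterThanLessThan M(2) that])
    then show ?thesis
      by (auto simp: holomorphic_on_def field_differentiable_def intro: has_field_derivative_at_within)
  qed
  have FF: "F \<mu> z - F \<nu> z = 0" if z: "Re z \<in> {\<alpha><..<\<beta>}" for z
  proof (rule analytic_continuation[where f = "\<lambda>z. F \<mu> z - F \<nu> z" and S = "{z. Re z \<in> {\<alpha><..<\<beta>}}"
        and U = "complex_of_real ` {\<alpha><..<\<beta>}" and \<xi> = "of_real t1"])
    have strip: "{z. Re z \<in> {\<alpha><..<\<beta>}} = {z. Re z > \<alpha>} \<inter> {z. Re z < \<beta>}" by auto
    show "open {z. Re z \<in> {\<alpha><..<\<beta>}}"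
      unfolding strip by (intro open_Int open_halfspace_Re_gt open_halfspace_Re_lt)
    show "connected {z. Re z \<in> {\<alpha><..<\<beta>}}"
      unfolding strip by (intro convex_connected convex_Int convex_halfspace_Re_gt convex_halfspace_Re_lt)
    show "(\<lambda>z. F \<mu> z - F \<nu> z) holomorphic_on {z. Re z \<in> {\<alpha><..<\<beta>}}"
      by (intro holomorphic_on_diff hol sets int)
    show "complex_of_real t1 islimpt complex_of_real ` {\<alpha><..<\<beta>}"
      unfolding islimpt_approachable
    proof (intro allI impI)
      fix e :: real assume e: "e > 0"
      define y where "y = t1 + min (e / 2) ((\<beta> - t1) / 2)"
      have "y \<in> {\<alpha><..<\<beta>}" "y \<noteq> t1" "\<bar>y - t1\<bar> < e" using e t1 by (auto simp: y_def min_def field_simps)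
      then show "\<exists>x'\<in>complex_of_real ` {\<alpha><..<\<beta>}. x' \<noteq> complex_of_real t1 \<and> dist x' (complex_of_real t1) < e"
        by (intro bexI[of _ "of_real y"]) (auto simp: dist_norm simp flip: of_real_diff)
    qed
    show "F \<mu> x - F \<nu> x = 0" if "x \<in> complex_of_real ` {\<alpha><..<\<beta>}" for x
      using that eq by (auto simp: F_real)
  qed (use z t1 in auto)
  define m where "m = (\<integral>l. exp (- l * t1) \<partial>\<mu>)"
  have m_nu: "m = (\<integral>l. exp (- l * t1) \<partial>\<nu>)" using eq[OF t1] by (simp add: m_def)
  show ?thesis
  \<comment> \<open>A zero mass cannot be normalised. In that case the positive function
    \<open>exp (- l * t1)\<close> has integral zero, so both measures vanish.\<close>
  proof (cases "m = 0")
    case True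
    have null: "emeasure M A = 0"
      if M: "sets M = sets borel" "integrable M (\<lambda>l. exp (- l * t1))"
        "(\<integral>l. exp (- l * t1) \<partial>M) = 0" for M :: "real measure" and A
    proof -
      have "AE l in M. exp (- l * t1) = 0"
        using M by (subst (asm) integral_nonneg_eq_0_iff_AE) auto
      then have "AE l in M. False" by simp
      then have "emeasure M (space M) = 0" by (simp add: AE_iff_measurable[OF _ refl])
      then show ?thesis using emeasure_space[of M A] by simp
    qed
    show ?thesis
      by (rule measure_eqI) (use sets null[OF sets(1) int(1)[OF t1]] null[OF sets(2) int(2)[OF t1]]
          True m_nu in \<open>auto simp: m_def\<close>)
  next
    case False
    then have m: "m > 0" unfolding m_def by (simp add: less_le)
    define P where "P M = density M (\<lambda>l. ennreal (exp (- l * t1) / m))" for M :: "real measure"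
    have P: "real_distribution (P M)" "char (P M) t = F M (Complex t1 (- t)) / of_real m"
        "M = density (P M) (\<lambda>l. ennreal (exp (l * t1) * m))"
      if M: "sets M = sets borel" "integrable M (\<lambda>l. exp (- l * t1))"
        "(\<integral>l. exp (- l * t1) \<partial>M) = m" for M :: "real measure" and t
    proof -
      have [measurable_cong]: "sets M = sets borel" by fact
      have "emeasure (P M) (space (P M)) = (\<integral>\<^sup>+ l. ennreal (exp (- l * t1) / m) \<partial>M)"
        unfolding P_def by (subst emeasure_density) (auto intro!: nn_integral_cong)
      also have "\<dots> = ennreal (\<integral>l. exp (- l * t1) / m \<partial>M)"
        using M m by (intro nn_integral_eq_integral) auto
      also have "\<dots> = 1" using M m by simp
      finally have "prob_space (P M)" by (rule prob_spaceI)
      then show "real_distribution (P M)"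
        unfolding real_distribution_def real_distribution_axioms_def by (simp add: P_def M(1))
      have "char (P M) t = (\<integral>l. (exp (- l * t1) / m) *\<^sub>R iexp (t * l) \<partial>M)"
        unfolding char_def P_def using m by (subst integral_density) auto
      also have "\<dots> = (\<integral>l. exp (- complex_of_real l * Complex t1 (- t)) / of_real m \<partial>M)"
      proof (rule Bochner_Integration.integral_cong[OF refl])
        fix l
        have "- complex_of_real l * Complex t1 (- t) = of_real (- l * t1) + \<i> * of_real (t * l)"
          by (simp add: complex_eq_iff)
        then have "exp (- complex_of_real l * Complex t1 (- t)) = of_real (exp (- l * t1)) * iexp (t * l)"
          by (simp only: exp_add exp_of_real)
        then show "(exp (- l * t1) / m) *\<^sub>R iexp (t * l) =
            exp (- complex_of_real l * Complex t1 (- t)) / of_real m"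
          by (simp add: scaleR_conv_of_real)
      qed
      also have "\<dots> = F M (Complex t1 (- t)) / of_real m" by (simp add: F_def)
      finally show "char (P M) t = F M (Complex t1 (- t)) / of_real m" .
      have "density (P M) (\<lambda>l. ennreal (exp (l * t1) * m)) =
          density M (\<lambda>l. ennreal (exp (- l * t1) / m) * ennreal (exp (l * t1) * m))"
        unfolding P_def by (subst density_density_eq) auto
      also have "\<dots> = density M (\<lambda>l. 1)"
        using m by (intro arg_cong[of _ _ "density M"] ext)
          (simp add: ennreal_mult[symmetric] mult_exp_exp)
      finally show "M = density (P M) (\<lambda>l. ennreal (exp (l * t1) * m))" by (simp add: density_1)
    qed
    have "P \<mu> = P \<nu>"
    proof (rule Levy_uniqueness)
      show "char (P \<mu>) = char (P \<nu>)"
        using FF[of "Complex t1 (- t)" for t] t1 P(2)[OF sets(1) int(1)[OF t1]]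
          P(2)[OF sets(2) int(2)[OF t1]] m_nu by (auto simp: m_def)
    qed (use P(1) sets int t1 m_nu m_def in auto)
    then show ?thesis
      using P(3)[OF sets(1) int(1)[OF t1]] P(3)[OF sets(2) int(2)[OF t1]] m_nu m_def by metis
  qed
qed

subsection \<open>Functions given by the integral representation\<close>

definition efun' :: "real \<Rightarrow> real \<Rightarrow> real \<Rightarrow> real" where
  "efun' m l t = (if l = 0 then - (t - m) else (exp (- l * (t - m)) - 1) / l)"

lemma efun_has_derivative: "(efun m l has_real_derivative efun' m l t) (at t)"
proof (cases "l = 0")
  case True
  then have "efun m l = (\<lambda>t. - ((t - m)\<^sup>2 / 2))" by (simp add: efun_def fun_eq_iff)
  moreover have "((\<lambda>t. - ((t - m)\<^sup>2 / 2)) has_real_derivative - (t - m)) (at t)"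
    by (auto intro!: derivative_eq_intros simp: field_simps)
  ultimately show ?thesis using True by (simp add: efun'_def)
next
  case False
  then have "efun m l = (\<lambda>t. (1 - l * (t - m) - exp (- l * (t - m))) / l\<^sup>2)"
    by (simp add: efun_def fun_eq_iff)
  moreover have "((\<lambda>t. (1 - l * (t - m) - exp (- l * (t - m))) / l\<^sup>2) has_real_derivative
      (exp (- l * (t - m)) - 1) / l) (at t)"
    using False by (auto intro!: derivative_eq_intros simp: field_simps power2_eq_square)
  ultimately show ?thesis using False by (simp add: efun'_def)
qed

lemma efun'_has_derivative: "(efun' m l has_real_derivative - exp (- l * (t - m))) (at t)"
proof (cases "l = 0")
  case True
  then have "efun' m l = (\<lambda>t. - (t - m))" by (simp add: efun'_def fun_eq_iff)
  then show ?thesis using True by (auto intro!: derivative_eq_intros)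
next
  case False
  then have "efun' m l = (\<lambda>t. (exp (- l * (t - m)) - 1) / l)"
    by (simp add: efun'_def fun_eq_iff)
  moreover have "((\<lambda>t. (exp (- l * (t - m)) - 1) / l) has_real_derivative - exp (- l * (t - m))) (at t)"
    using False by (auto intro!: derivative_eq_intros simp: field_simps)
  ultimately show ?thesis by simp
qed

lemma measurable_efun [measurable]: "(\<lambda>l. efun m l t) \<in> borel_measurable borel"
  unfolding efun_def by measurable

lemma measurable_efun' [measurable]: "(\<lambda>l. efun' m l t) \<in> borel_measurable borel"
  unfolding efun'_def by measurable

text \<open>By \<open>1 + x \<le> exp x\<close>, applied to \<open>x\<close> and to
  \<open>- x\<close>, the number \<open>exp x - 1\<close> lies between \<open>x\<close> and
  \<open>x * exp x\<close>.\<close>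

lemma abs_exp_minus_one_le: "\<bar>exp x - 1\<bar> \<le> \<bar>x\<bar> * (1 + exp (x::real))"
proof -
  have "exp x * (1 + (- x)) \<le> exp x * exp (- x)"
    by (intro mult_left_mono exp_ge_add_one_self) auto
  then have 1: "exp x - 1 \<le> x * exp x" by (simp add: mult_exp_exp algebra_simps)
  have 2: "x \<le> exp x - 1" using exp_ge_add_one_self[of x] by linarith
  show ?thesis
  proof (cases "x \<ge> 0")
    case True
    then show ?thesis using 1 2 by (simp add: algebra_simps)
  next
    case False
    then have "x * exp x \<le> 0" by (simp add: mult_le_0_iff)
    moreover have "exp x \<le> 1" using False by simp
    moreover have "1 + (x + x * exp x) \<le> exp x" using calculation 2 by linarith
    ultimately show ?thesis using False by (simp add: algebra_simps)
  qed
qed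

lemma abs_exp_taylor_le: "\<bar>exp x - 1 - x\<bar> \<le> x\<^sup>2 * (1 + exp (x::real))"
proof -
  have "exp x * (1 + (- x)) \<le> exp x * exp (- x)"
    by (intro mult_left_mono exp_ge_add_one_self) auto
  then have "exp x - 1 - x \<le> x * (exp x - 1)" by (simp add: mult_exp_exp algebra_simps)
  also have "\<dots> \<le> \<bar>x\<bar> * \<bar>exp x - 1\<bar>" by (metis abs_ge_self abs_mult)
  also have "\<dots> \<le> \<bar>x\<bar> * (\<bar>x\<bar> * (1 + exp x))" by (intro mult_left_mono abs_exp_minus_one_le) auto
  also have "\<dots> = x\<^sup>2 * (1 + exp x)" by (simp add: power2_eq_square)
  finally show ?thesis using exp_ge_add_one_self[of x] by (smt (verit))
qed

text \<open>The factor \<open>|l|\<close> from the elementary bound cancels the apparent pole at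
  \<open>l = 0\<close>. With the weight, only integrands of the Laplace transform at
  \<open>m\<close> and at \<open>t\<close> remain; the analogous bound for \<open>efun\<close>
  arises from two such factors.\<close>

lemma abs_efun'_le:
  "\<bar>efun' m l t\<bar> * exp (- l * m) \<le> \<bar>t - m\<bar> * (exp (- l * m) + exp (- l * t))"
proof -
  have "\<bar>efun' m l t\<bar> \<le> \<bar>t - m\<bar> * (1 + exp (- l * (t - m)))"
  proof (cases "l = 0")
    case False
    have "\<bar>exp (- l * (t - m)) - 1\<bar> \<le> \<bar>- l * (t - m)\<bar> * (1 + exp (- l * (t - m)))"
      by (rule abs_exp_minus_one_le)
    also have "\<bar>- l * (t - m)\<bar> = \<bar>l\<bar> * \<bar>t - m\<bar>" by (simp add: abs_mult)
    finally show ?thesis using False by (simp add: efun'_def abs_divide divide_le_eq mult_ac)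
  qed (simp add: efun'_def abs_if)
  then have "\<bar>efun' m l t\<bar> * exp (- l * m) \<le> \<bar>t - m\<bar> * (1 + exp (- l * (t - m))) * exp (- l * m)"
    by (rule mult_right_mono) simp
  also have "\<dots> = \<bar>t - m\<bar> * (exp (- l * m) + exp (- l * t))"
    by (simp add: algebra_simps mult_exp_exp)
  finally show ?thesis .
qed

lemma abs_efun_le:
  "\<bar>efun m l t\<bar> * exp (- l * m) \<le> (t - m)\<^sup>2 * (exp (- l * m) + exp (- l * t))"
proof -
  have "\<bar>efun m l t\<bar> \<le> (t - m)\<^sup>2 * (1 + exp (- l * (t - m)))"
  proof (cases "l = 0")
    case False
    have "\<bar>1 - l * (t - m) - exp (- l * (t - m))\<bar> = \<bar>exp (- l * (t - m)) - 1 - (- l * (t - m))\<bar>"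
      by simp
    also have "\<dots> \<le> (- l * (t - m))\<^sup>2 * (1 + exp (- l * (t - m)))"
      by (rule abs_exp_taylor_le)
    also have "(- l * (t - m))\<^sup>2 = l\<^sup>2 * (t - m)\<^sup>2" by (simp add: power_mult_distrib)
    finally show ?thesis using False by (simp add: efun_def abs_divide divide_le_eq mult_ac)
  qed (simp add: efun_def)
  then have "\<bar>efun m l t\<bar> * exp (- l * m) \<le> (t - m)\<^sup>2 * (1 + exp (- l * (t - m))) * exp (- l * m)"
    by (rule mult_right_mono) simp
  also have "\<dots> = (t - m)\<^sup>2 * (exp (- l * m) + exp (- l * t))"
    by (simp add: algebra_simps mult_exp_exp)
  finally show ?thesis .
qed

lemma efun_integrable:
  assumes sets: "sets \<mu> = sets borel"
    and "integrable \<mu> (\<lambda>l. exp (- l * m))" "integrable \<mu> (\<lambda>l. exp (- l * t))"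
  shows "integrable \<mu> (\<lambda>l. efun m l t * exp (- l * m))"
proof (rule Bochner_Integration.integrable_bound)
  have [measurable_cong]: "sets \<mu> = sets borel" by fact
  show "integrable \<mu> (\<lambda>l. (t - m)\<^sup>2 * (exp (- l * m) + exp (- l * t)))"
    by (intro integrable_mult_right Bochner_Integration.integrable_add assms)
  show "(\<lambda>l. efun m l t * exp (- l * m)) \<in> borel_measurable \<mu>" by measurable
qed (use abs_efun_le in \<open>auto simp: abs_mult\<close>)

lemma efun'_integrable:
  assumes sets: "sets \<mu> = sets borel"
    and "integrable \<mu> (\<lambda>l. exp (- l * m))" "integrable \<mu> (\<lambda>l. exp (- l * t))"
  shows "integrable \<mu> (\<lambda>l. efun' m l t * exp (- l * m))"
proof (rule Bochner_Integration.integrable_bound)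
  have [measurable_cong]: "sets \<mu> = sets borel" by fact
  show "integrable \<mu> (\<lambda>l. \<bar>t - m\<bar> * (exp (- l * m) + exp (- l * t)))"
    by (intro integrable_mult_right Bochner_Integration.integrable_add assms)
  show "(\<lambda>l. efun' m l t * exp (- l * m)) \<in> borel_measurable \<mu>" by measurable
qed (use abs_efun'_le in \<open>auto simp: abs_mult\<close>)

lemma levy_khinchin_integrable_exp:
  assumes sets: "sets \<mu> = sets borel" and rep: "levy_khinchin_rep S m \<psi> c d \<mu>"
    and S: "open S" "t \<in> S"
  shows "integrable \<mu> (\<lambda>l. exp (- l * t))"
proof -
  have [measurable_cong]: "sets \<mu> = sets borel" by fact
  obtain \<delta> where \<delta>: "\<delta> > 0" "{t - 2 * \<delta>..t + 2 * \<delta>} \<subseteq> S"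
    using interval_in_open[OF S] by blast
  have int: "integrable \<mu> (\<lambda>l. efun m l u * exp (- l * m))" if "u \<in> S" for u
    using rep that by (auto simp: levy_khinchin_rep_def)
  have t: "t \<in> S" "t + \<delta> \<in> S" "t - \<delta> \<in> S" using \<delta> by (auto simp: subset_iff)
  \<comment> \<open>This combination of kernels equals
    \<open>exp (- l * t) * (cosh_kernel \<delta> l / \<delta>\<^sup>2)\<close>, whose second factor
    is at least 1.\<close>
  have gint: "integrable \<mu> (\<lambda>l. - 1 / \<delta>\<^sup>2 * (efun m l (t + \<delta>) * exp (- l * m) -
      2 * (efun m l t * exp (- l * m)) + efun m l (t - \<delta>) * exp (- l * m)))"
    by (intro integrable_mult_right Bochner_Integration.integrable_add
        Bochner_Integration.integrable_diff int t)
  show ?thesis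
  proof (rule Bochner_Integration.integrable_bound[OF gint])
    show "(\<lambda>l. exp (- l * t)) \<in> borel_measurable \<mu>" by measurable
    show "AE l in \<mu>. norm (exp (- l * t)) \<le> norm (- 1 / \<delta>\<^sup>2 * (efun m l (t + \<delta>) * exp (- l * m) -
      2 * (efun m l t * exp (- l * m)) + efun m l (t - \<delta>) * exp (- l * m)))"
    proof (rule AE_I2)
      fix l
      have "efun m l (t + \<delta>) * exp (- l * m) - 2 * (efun m l t * exp (- l * m)) +
          efun m l (t - \<delta>) * exp (- l * m) =
          (efun m l (t + \<delta>) - 2 * efun m l t + efun m l (t - \<delta>)) * exp (- l * m)"
        by (simp only: algebra_simps)
      also have "\<dots> = - (exp (- l * t) * cosh_kernel \<delta> l)"
        unfolding efun_second_difference by (simp add: algebra_simps mult_exp_exp)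
      finally have e: "- 1 / \<delta>\<^sup>2 * (efun m l (t + \<delta>) * exp (- l * m) -
          2 * (efun m l t * exp (- l * m)) + efun m l (t - \<delta>) * exp (- l * m)) =
          exp (- l * t) * (cosh_kernel \<delta> l / \<delta>\<^sup>2)" by simp
      have "1 \<le> cosh_kernel \<delta> l / \<delta>\<^sup>2" using cosh_kernel_ge[of \<delta> l] \<delta>(1) by (simp add: le_divide_eq)
      then have "exp (- l * t) * 1 \<le> exp (- l * t) * (cosh_kernel \<delta> l / \<delta>\<^sup>2)"
        by (intro mult_left_mono) auto
      then show "norm (exp (- l * t)) \<le> norm (- 1 / \<delta>\<^sup>2 * (efun m l (t + \<delta>) * exp (- l * m) -
          2 * (efun m l t * exp (- l * m)) + efun m l (t - \<delta>) * exp (- l * m)))"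
        unfolding e real_norm_def abs_exp_cancel mult_1_right by (rule order.trans[OF _ abs_ge_self])
    qed
  qed
qed

lemma efun_integral_has_derivative:
  assumes sets: "sets \<mu> = sets borel" and S: "open S" "m \<in> S" "t \<in> S"
    and int: "\<And>t. t \<in> S \<Longrightarrow> integrable \<mu> (\<lambda>l. exp (- l * t))"
  shows "((\<lambda>t. \<integral>l. efun m l t * exp (- l * m) \<partial>\<mu>) has_real_derivative
       (\<integral>l. efun' m l t * exp (- l * m) \<partial>\<mu>)) (at t)" (is ?D1)
    and "((\<lambda>t. \<integral>l. efun' m l t * exp (- l * m) \<partial>\<mu>) has_real_derivative
       - (\<integral>l. exp (- l * t) \<partial>\<mu>)) (at t)" (is ?D2)
proof -
  have [measurable_cong]: "sets \<mu> = sets borel" by fact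
  obtain \<delta> where \<delta>: "\<delta> > 0" "{t - 2 * \<delta>..t + 2 * \<delta>} \<subseteq> S"
    using interval_in_open[OF S(1,3)] by blast
  have ball: "y \<in> S" "y \<in> {t - 2 * \<delta>..t + 2 * \<delta>}" "\<bar>y - m\<bar> \<le> \<bar>t - m\<bar> + \<delta>" if "y \<in> ball t \<delta>" for y
  proof -
    have "\<bar>t - y\<bar> < \<delta>" using that by (simp add: dist_real_def)
    then show "y \<in> {t - 2 * \<delta>..t + 2 * \<delta>}" "\<bar>y - m\<bar> \<le> \<bar>t - m\<bar> + \<delta>" by auto
    then show "y \<in> S" using \<delta> by blast
  qed
  have ends: "t - 2 * \<delta> \<in> S" "t + 2 * \<delta> \<in> S" using \<delta> by (auto simp: subset_iff)
  show ?D1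
  proof (rule has_field_derivative_integral[OF \<delta>(1)])
    \<comment> \<open>The majorant is the pointwise bound for \<open>efun'\<close> at
      \<open>y\<close>, with \<open>|y - m|\<close> and \<open>exp (- l * y)\<close> replaced by
      bounds independent of \<open>y\<close> in the ball.\<close>
    show "integrable \<mu> (\<lambda>l. (\<bar>t - m\<bar> + \<delta>) * (exp (- l * m) +
        (exp (- l * (t - 2 * \<delta>)) + exp (- l * (t + 2 * \<delta>)))))"
      by (intro integrable_mult_right Bochner_Integration.integrable_add int ends S)
    show "(\<lambda>l. efun' m l t * exp (- l * m)) \<in> borel_measurable \<mu>" by measurable
    fix y assume y: "y \<in> ball t \<delta>"
    show "integrable \<mu> (\<lambda>l. efun m l y * exp (- l * m))"
      by (intro efun_integrable sets int ball(1)[OF y] S)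
    fix l
    show "((\<lambda>y. efun m l y * exp (- l * m)) has_real_derivative efun' m l y * exp (- l * m)) (at y)"
      by (rule DERIV_cmult_right[OF efun_has_derivative])
    have "\<bar>efun' m l y\<bar> * exp (- l * m) \<le> \<bar>y - m\<bar> * (exp (- l * m) + exp (- l * y))"
      by (rule abs_efun'_le)
    also have "\<dots> \<le> (\<bar>t - m\<bar> + \<delta>) * (exp (- l * m) +
        (exp (- l * (t - 2 * \<delta>)) + exp (- l * (t + 2 * \<delta>))))"
      using \<delta>(1) by (intro mult_mono add_mono order_refl exp_le_endpoints ball y) (auto intro: add_nonneg_nonneg)
    finally show "norm (efun' m l y * exp (- l * m)) \<le> (\<bar>t - m\<bar> + \<delta>) * (exp (- l * m) +
        (exp (- l * (t - 2 * \<delta>)) + exp (- l * (t + 2 * \<delta>))))" by (simp add: abs_mult)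
  qed
  have "((\<lambda>t. \<integral>l. efun' m l t * exp (- l * m) \<partial>\<mu>) has_real_derivative
       (\<integral>l. - exp (- l * t) \<partial>\<mu>)) (at t)"
  proof (rule has_field_derivative_integral[OF \<delta>(1)])
    show "integrable \<mu> (\<lambda>l. exp (- l * (t - 2 * \<delta>)) + exp (- l * (t + 2 * \<delta>)))"
      by (intro Bochner_Integration.integrable_add int ends S)
    show "(\<lambda>l. - exp (- l * t)) \<in> borel_measurable \<mu>" by measurable
    fix y assume y: "y \<in> ball t \<delta>"
    show "integrable \<mu> (\<lambda>l. efun' m l y * exp (- l * m))"
      by (intro efun'_integrable sets int ball(1)[OF y] S)
    fix l
    have "((\<lambda>y. efun' m l y * exp (- l * m)) has_real_derivative - exp (- l * (y - m)) * exp (- l * m)) (at y)"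
      by (rule DERIV_cmult_right[OF efun'_has_derivative])
    then show "((\<lambda>y. efun' m l y * exp (- l * m)) has_real_derivative - exp (- l * y)) (at y)"
      by (simp add: mult_exp_exp algebra_simps)
    show "norm (- exp (- l * y)) \<le> exp (- l * (t - 2 * \<delta>)) + exp (- l * (t + 2 * \<delta>))"
      using exp_le_endpoints[OF ball(2)[OF y]] by simp
  qed
  then show ?D2 by simp
qed

text \<open>Both \<open>efun\<close> and \<open>efun'\<close> vanish at the base point, which
  isolates \<open>c\<close> and \<open>d\<close>. Since the formula for the first derivative holds
  on the whole open set, \<open>deriv \<psi>\<close> may itself be differentiated.\<close>

lemma levy_khinchin_rep_derivatives:
  assumes sets: "sets \<mu> = sets borel" and rep: "levy_khinchin_rep S m \<psi> c d \<mu>"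
    and S: "open S" "m \<in> S" "t \<in> S"
  shows "c = \<psi> m" and "(\<psi> has_real_derivative d) (at m)"
    and "(\<psi> has_real_derivative d + (\<integral>l. efun' m l t * exp (- l * m) \<partial>\<mu>)) (at t)"
    and "(deriv \<psi> has_real_derivative - (\<integral>l. exp (- l * t) \<partial>\<mu>)) (at t)"
proof -
  have int: "integrable \<mu> (\<lambda>l. exp (- l * t))" if "t \<in> S" for t
    using levy_khinchin_integrable_exp[OF sets rep S(1) that] .
  have psi: "\<psi> t = c + d * (t - m) + (\<integral>l. efun m l t * exp (- l * m) \<partial>\<mu>)" if "t \<in> S" for t
    using rep that by (simp add: levy_khinchin_rep_def)
  have e0: "efun m l m = 0" "efun' m l m = 0" for l by (simp_all add: efun_def efun'_def)
  show "c = \<psi> m" using psi[OF S(2)] by (simp add: e0)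
  have D: "(\<psi> has_real_derivative d + (\<integral>l. efun' m l t * exp (- l * m) \<partial>\<mu>)) (at t)" if t: "t \<in> S" for t
  proof (rule has_field_derivative_transform_within_open[OF _ S(1) t])
    show "((\<lambda>t. c + d * (t - m) + (\<integral>l. efun m l t * exp (- l * m) \<partial>\<mu>)) has_real_derivative
        d + (\<integral>l. efun' m l t * exp (- l * m) \<partial>\<mu>)) (at t)"
      by (rule derivative_eq_intros efun_integral_has_derivative(1)[OF sets S(1,2) t int] refl | simp)+
  qed (use psi in auto)
  show "(\<psi> has_real_derivative d) (at m)" using D[OF S(2)] by (simp add: e0)
  show "(\<psi> has_real_derivative d + (\<integral>l. efun' m l t * exp (- l * m) \<partial>\<mu>)) (at t)"
    by (rule D[OF S(3)])
  show "(deriv \<psi> has_real_derivative - (\<integral>l. exp (- l * t) \<partial>\<mu>)) (at t)"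
  proof (rule has_field_derivative_transform_within_open[OF _ S(1,3)])
    show "((\<lambda>t. d + (\<integral>l. efun' m l t * exp (- l * m) \<partial>\<mu>)) has_real_derivative
        - (\<integral>l. exp (- l * t) \<partial>\<mu>)) (at t)"
      by (rule derivative_eq_intros efun_integral_has_derivative(2)[OF sets S int] refl | simp)+
    show "d + (\<integral>l. efun' m l t * exp (- l * m) \<partial>\<mu>) = deriv \<psi> t" if "t \<in> S" for t
      using DERIV_imp_deriv[OF D[OF that]] by simp
  qed
qed

text \<open>Terms depending on only one of \<open>j\<close>, \<open>k\<close> are killed by the zero
  sum. What remains of the kernel is minus a rank-one form: the exponential at a midpoint is a
  product of values at \<open>x j\<close> and \<open>x k\<close>. With the free scalars the lemma
  covers the integrand (\<open>a = b = 0\<close>) and the affine part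
  (\<open>q = 0\<close>).\<close>

lemma quadratic_form_efun:
  fixes c :: "nat \<Rightarrow> complex" and x :: "nat \<Rightarrow> real"
  assumes c: "(\<Sum>j<n. c j) = 0"
  shows "\<exists>r\<ge>0. (\<Sum>j<n. \<Sum>k<n. c j * cnj (c k) *
           complex_of_real (a + b * ((x j + x k) / 2 - m) + q * efun m l ((x j + x k) / 2))) =
         of_real (- (q * r))"
proof -
  have form: "(\<Sum>j<n. \<Sum>k<n. c j * cnj (c k) * complex_of_real (p j + p k - q * (s * (v j * v k)))) =
      of_real (- (q * (s * (cmod (\<Sum>j<n. c j * of_real (v j)))\<^sup>2)))"
    for p v :: "nat \<Rightarrow> real" and s
  proof -
    define V where "V = (\<Sum>j<n. c j * of_real (v j))"
    have "(\<Sum>j<n. \<Sum>k<n. c j * cnj (c k) * complex_of_real (p j + p k - q * (s * (v j * v k)))) =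
       (\<Sum>j<n. \<Sum>k<n. (c j * of_real (p j)) * cnj (c k)) +
       (\<Sum>j<n. \<Sum>k<n. c j * (cnj (c k) * of_real (p k))) -
       (\<Sum>j<n. \<Sum>k<n. of_real (q * s) * ((c j * of_real (v j)) * cnj (c k * of_real (v k))))"
      unfolding sum_subtractf[symmetric] sum.distrib[symmetric]
      by (intro sum.cong refl) (simp add: algebra_simps)
    also have "(\<Sum>j<n. \<Sum>k<n. (c j * of_real (p j)) * cnj (c k)) =
        (\<Sum>j<n. c j * of_real (p j)) * cnj (\<Sum>k<n. c k)"
      by (simp add: sum_product)
    also have "(\<Sum>j<n. \<Sum>k<n. c j * (cnj (c k) * of_real (p k))) =
        (\<Sum>j<n. c j) * (\<Sum>k<n. cnj (c k) * of_real (p k))"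
      by (simp add: sum_product)
    also have "(\<Sum>j<n. \<Sum>k<n. of_real (q * s) * ((c j * of_real (v j)) * cnj (c k * of_real (v k)))) =
        of_real (q * s) * (V * cnj V)"
      by (simp only: V_def sum_distrib_left[symmetric] sum_product cnj_sum)
    finally show ?thesis
      using c by (simp add: V_def[symmetric] complex_norm_square[symmetric] mult.assoc flip: of_real_power)
  qed
  show ?thesis
  proof (cases "l = 0")
    case True
    \<comment> \<open>For \<open>l = 0\<close> the kernel is minus one eighth of the square of
      \<open>(x j - m) + (x k - m)\<close>, so only its mixed term, with coefficient
      \<open>1 / 4\<close>, survives the zero sum.\<close>
    have "a + b * ((x j + x k) / 2 - m) + q * efun m l ((x j + x k) / 2) =
        (a / 2 + b * (x j - m) / 2 - q * (x j - m)\<^sup>2 / 8) + (a / 2 + b * (x k - m) / 2 - q * (x k - m)\<^sup>2 / 8)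
        - q * (1 / 4 * ((x j - m) * (x k - m)))" for j k
      using True by (simp add: efun_def field_simps power2_eq_square)
    then show ?thesis
      by (intro exI[of _ "1 / 4 * (cmod (\<Sum>j<n. c j * of_real (x j - m)))\<^sup>2"]) (simp only: form, simp)
  next
    case False
    have "a + b * ((x j + x k) / 2 - m) + q * efun m l ((x j + x k) / 2) =
        (a / 2 + b * (x j - m) / 2 + q * ((1 / 2 - l * (x j - m) / 2) / l\<^sup>2)) +
        (a / 2 + b * (x k - m) / 2 + q * ((1 / 2 - l * (x k - m) / 2) / l\<^sup>2))
        - q * (1 / l\<^sup>2 * (exp (- l * (x j - m) / 2) * exp (- l * (x k - m) / 2)))" for j k
    proof -
      have e: "exp (- l * (x j - m) / 2) * exp (- l * (x k - m) / 2) = exp (- l * ((x j + x k) / 2 - m))"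
        by (simp add: mult_exp_exp field_simps)
      have "efun m l ((x j + x k) / 2) = (1 / 2 - l * (x j - m) / 2) / l\<^sup>2 + (1 / 2 - l * (x k - m) / 2) / l\<^sup>2
          - 1 / l\<^sup>2 * exp (- l * ((x j + x k) / 2 - m))"
        using False unfolding efun_def by (simp add: diff_divide_distrib add_divide_distrib algebra_simps)
      moreover have "a + b * ((x j + x k) / 2 - m) + q * (U + V - W) =
          (a / 2 + b * (x j - m) / 2 + q * U) + (a / 2 + b * (x k - m) / 2 + q * V) - q * W" for U V W
        by (simp add: field_simps)
      ultimately show ?thesis unfolding e by simp
    qed
    then show ?thesis
      by (intro exI[of _ "1 / l\<^sup>2 * (cmod (\<Sum>j<n. c j * of_real (exp (- l * (x j - m) / 2))))\<^sup>2"])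
         (simp only: form, simp)
  qed
qed

lemma levy_khinchin_rep_negative_definite:
  assumes rep: "levy_khinchin_rep S m \<psi> a b \<mu>" and S: "convex S"
  shows "negative_definite_on S \<psi>"
  unfolding negative_definite_on_def negative_definite_kernel_def
proof (intro allI impI)
  fix n and x :: "nat \<Rightarrow> real" and c :: "nat \<Rightarrow> complex"
  assume x: "\<forall>j<n. x j \<in> S" and c: "(\<Sum>j<n. c j) = 0"
  have mid: "(x j + x k) / 2 \<in> S" if "j < n" "k < n" for j k
    using convexD[OF S, of "x j" "x k" "1/2" "1/2"] x that by (simp add: field_simps)
  have int: "integrable \<mu> (\<lambda>l. efun m l t * exp (- l * m))" if "t \<in> S" for t
    using rep that by (simp add: levy_khinchin_rep_def)
  define e where "e l j k = c j * cnj (c k) * complex_of_real (efun m l ((x j + x k) / 2) * exp (- l * m))" for l j k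
  have inte: "integrable \<mu> (\<lambda>l. e l j k)" if "j < n" "k < n" for j k
    unfolding e_def using int[OF mid[OF that]]
    by (intro integrable_mult_right integrable_of_real)
  have "\<exists>r\<ge>0. (\<Sum>j<n. \<Sum>k<n. e l j k) = of_real (- r)" for l
  proof -
    have e: "e l j k = c j * cnj (c k) * complex_of_real (0 + 0 * ((x j + x k) / 2 - m) +
        exp (- l * m) * efun m l ((x j + x k) / 2))" for j k
      by (simp add: e_def mult.commute)
    obtain r where "r \<ge> 0" "(\<Sum>j<n. \<Sum>k<n. e l j k) = of_real (- (exp (- l * m) * r))"
      using quadratic_form_efun[OF c, of 0 0 x m "exp (- l * m)" l] unfolding e by blast
    then show ?thesis by (intro exI[of _ "exp (- l * m) * r"]) simp
  qed
  then obtain r where r: "\<And>l. r l \<ge> 0" "\<And>l. (\<Sum>j<n. \<Sum>k<n. e l j k) = of_real (- r l)" by metis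
  \<comment> \<open>The affine part carries a kernel term with factor \<open>0\<close> so that it
    has the shape of \<open>quadratic_form_efun\<close>.\<close>
  have psi: "complex_of_real (\<psi> ((x j + x k) / 2)) * (c j * cnj (c k)) =
     c j * cnj (c k) * complex_of_real (a + b * ((x j + x k) / 2 - m) + 0 * efun m 0 ((x j + x k) / 2)) +
     (\<integral>l. e l j k \<partial>\<mu>)" if "j < n" "k < n" for j k
  proof -
    have "(\<integral>l. e l j k \<partial>\<mu>) = c j * cnj (c k) *
        complex_of_real (\<integral>l. efun m l ((x j + x k) / 2) * exp (- l * m) \<partial>\<mu>)"
      unfolding e_def integral_mult_right_zero integral_complex_of_real ..
    moreover have "\<psi> ((x j + x k) / 2) = a + b * ((x j + x k) / 2 - m) +
        (\<integral>l. efun m l ((x j + x k) / 2) * exp (- l * m) \<partial>\<mu>)"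
      using rep mid[OF that] by (simp add: levy_khinchin_rep_def)
    ultimately show ?thesis
      by (simp only: of_real_add distrib_left mult_zero_left add_0_right mult_ac)
  qed
  have "(\<Sum>j<n. \<Sum>k<n. c j * cnj (c k) * complex_of_real (\<psi> ((x j + x k) / 2))) =
     (\<Sum>j<n. \<Sum>k<n. c j * cnj (c k) *
        complex_of_real (a + b * ((x j + x k) / 2 - m) + 0 * efun m 0 ((x j + x k) / 2))) +
     (\<Sum>j<n. \<Sum>k<n. (\<integral>l. e l j k \<partial>\<mu>))"
    unfolding sum.distrib[symmetric] by (intro sum.cong refl) (simp only: psi[symmetric] lessThan_iff mult.commute)
  also have "(\<Sum>j<n. \<Sum>k<n. c j * cnj (c k) *
        complex_of_real (a + b * ((x j + x k) / 2 - m) + 0 * efun m 0 ((x j + x k) / 2))) = 0"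
    using quadratic_form_efun[OF c, of a b x m 0 0] by auto
  also have "(\<Sum>j<n. \<Sum>k<n. (\<integral>l. e l j k \<partial>\<mu>)) = (\<integral>l. (\<Sum>j<n. \<Sum>k<n. e l j k) \<partial>\<mu>)"
  proof -
    have "(\<integral>l. (\<Sum>j<n. \<Sum>k<n. e l j k) \<partial>\<mu>) = (\<Sum>j<n. (\<integral>l. (\<Sum>k<n. e l j k) \<partial>\<mu>))"
      by (intro Bochner_Integration.integral_sum Bochner_Integration.integrable_sum inte) auto
    also have "\<dots> = (\<Sum>j<n. \<Sum>k<n. (\<integral>l. e l j k \<partial>\<mu>))"
      by (intro sum.cong refl Bochner_Integration.integral_sum inte) auto
    finally show ?thesis ..
  qed
  also have "\<dots> = of_real (- (\<integral>l. r l \<partial>\<mu>))" by (simp add: r(2))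
  also have "0 + complex_of_real (- (\<integral>l. r l \<partial>\<mu>)) \<le> 0"
    using integral_nonneg_AE[of r \<mu>] r(1) by (simp add: less_eq_complex_def)
  finally show "(\<Sum>j<n. \<Sum>k<n. c j * cnj (c k) * complex_of_real (\<psi> ((x j + x k) / 2))) \<le> 0" .
qed

text \<open>For fixed \<open>l\<close> both weighted kernels have second derivative
  \<open>- exp (- l * t)\<close> in \<open>t\<close>. Their difference is affine in
  \<open>t\<close>, so moving the base point alters only the constants.\<close>

lemma levy_khinchin_rep_change_base:
  assumes sets: "sets \<mu> = sets borel" and S: "open S" "m \<in> S" "m' \<in> S"
    and rep: "levy_khinchin_rep S m \<psi> c d \<mu>"
  shows "\<exists>c' d'. levy_khinchin_rep S m' \<psi> c' d' \<mu>"
proof -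
  have int: "integrable \<mu> (\<lambda>l. exp (- l * t))" if "t \<in> S" for t
    using levy_khinchin_integrable_exp[OF sets rep S(1) that] .
  obtain \<delta> where \<delta>: "\<delta> > 0" "{m' - 2 * \<delta>..m' + 2 * \<delta>} \<subseteq> S"
    using interval_in_open[OF S(1,3)] by blast
  \<comment> \<open>Two points determine the affine function \<open>D l\<close>. Expressing its
    coefficients through the values at \<open>m'\<close> and \<open>t2\<close> makes their
    integrability in \<open>l\<close> immediate.\<close>
  define t2 where "t2 = m' + \<delta>"
  have t2: "t2 \<in> S" "t2 \<noteq> m'" using \<delta> by (auto simp: t2_def subset_iff)
  define D where "D l t = efun m l t * exp (- l * m) - efun m' l t * exp (- l * m')" for l t
  have D_int: "integrable \<mu> (\<lambda>l. D l t)" if "t \<in> S" for t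
    unfolding D_def by (intro Bochner_Integration.integrable_diff efun_integrable sets int that S)
  define k where "k t = (t - m') / (t2 - m')" for t
  have D_affine: "D l t = D l m' + k t * (D l t2 - D l m')" for l t
  proof -
    have "\<exists>\<alpha> \<beta>. \<forall>t. D l t = \<alpha> + \<beta> * (t - m')"
    proof (cases "l = 0")
      case True
      show ?thesis
        by (rule exI[of _ "- ((m' - m)\<^sup>2 / 2)"], rule exI[of _ "m - m'"])
           (simp add: True D_def efun_def field_simps power2_eq_square)
    next
      case False
      have "D l t = ((1 - l * (m' - m)) * exp (- l * m) - exp (- l * m')) / l\<^sup>2 +
          ((exp (- l * m') - exp (- l * m)) / l) * (t - m')" for t
      proof -
        have "exp (- l * (t - m)) * exp (- l * m) = exp (- l * t)"
          "exp (- l * (t - m')) * exp (- l * m') = exp (- l * t)"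
          by (simp_all add: mult_exp_exp algebra_simps)
        then have "D l t = ((1 - l * (t - m)) * exp (- l * m) - exp (- l * t)) / l\<^sup>2 -
            ((1 - l * (t - m')) * exp (- l * m') - exp (- l * t)) / l\<^sup>2"
          using False by (simp only: D_def efun_def if_False left_diff_distrib times_divide_eq_left)
        moreover have "((exp (- l * m') - exp (- l * m)) / l) * (t - m') =
            (l * ((exp (- l * m') - exp (- l * m)) * (t - m'))) / l\<^sup>2"
          by (simp add: power2_eq_square)
        ultimately show ?thesis
          by (simp only: add_divide_distrib[symmetric] diff_divide_distrib[symmetric])
             (simp add: algebra_simps)
      qed
      then show ?thesis by blast
    qed
    then obtain \<alpha> \<beta> where ab: "\<And>t. D l t = \<alpha> + \<beta> * (t - m')" by blast
    have "k t * (t2 - m') = t - m'" using t2 by (simp add: k_def)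
    then have "\<beta> * (t - m') = k t * (\<beta> * (t2 - m'))" by (metis mult.left_commute)
    then show ?thesis unfolding ab by simp
  qed
  show ?thesis
  proof (intro exI)
    show "levy_khinchin_rep S m' \<psi> (c + d * (m' - m) + (\<integral>l. D l m' \<partial>\<mu>))
        (d + (\<integral>l. D l t2 - D l m' \<partial>\<mu>) / (t2 - m')) \<mu>"
      unfolding levy_khinchin_rep_def
    proof (intro ballI conjI)
      fix t assume t: "t \<in> S"
      show i': "integrable \<mu> (\<lambda>l. efun m' l t * exp (- l * m'))"
        by (intro efun_integrable sets int t S)
      have "(\<integral>l. efun m l t * exp (- l * m) \<partial>\<mu>) = (\<integral>l. D l t + efun m' l t * exp (- l * m') \<partial>\<mu>)"
        by (simp add: D_def)
      also have "\<dots> = (\<integral>l. D l t \<partial>\<mu>) + (\<integral>l. efun m' l t * exp (- l * m') \<partial>\<mu>)"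
        by (intro Bochner_Integration.integral_add D_int t i')
      also have "(\<integral>l. D l t \<partial>\<mu>) = (\<integral>l. D l m' + k t * (D l t2 - D l m') \<partial>\<mu>)"
        by (intro Bochner_Integration.integral_cong refl D_affine)
      also have "\<dots> = (\<integral>l. D l m' \<partial>\<mu>) + k t * (\<integral>l. D l t2 - D l m' \<partial>\<mu>)"
        by (simp add: D_int t2 S Bochner_Integration.integral_add Bochner_Integration.integrable_diff
            del: Bochner_Integration.integral_diff)
      finally have I: "(\<integral>l. efun m l t * exp (- l * m) \<partial>\<mu>) = (\<integral>l. D l m' \<partial>\<mu>) +
          k t * (\<integral>l. D l t2 - D l m' \<partial>\<mu>) + (\<integral>l. efun m' l t * exp (- l * m') \<partial>\<mu>)" .
      have psi: "\<psi> t = c + d * (t - m) + (\<integral>l. efun m l t * exp (- l * m) \<partial>\<mu>)"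
        using rep t by (simp add: levy_khinchin_rep_def)
      have k: "(\<integral>l. D l t2 - D l m' \<partial>\<mu>) / (t2 - m') * (t - m') = k t * (\<integral>l. D l t2 - D l m' \<partial>\<mu>)"
        by (simp add: k_def)
      show "\<psi> t = c + d * (m' - m) + (\<integral>l. D l m' \<partial>\<mu>) +
          (d + (\<integral>l. D l t2 - D l m' \<partial>\<mu>) / (t2 - m')) * (t - m') +
          (\<integral>l. efun m' l t * exp (- l * m') \<partial>\<mu>)"
        unfolding psi I distrib_right k by (simp add: right_diff_distrib)
    qed
  qed
qed

subsection \<open>Passage to the limit\<close>

text \<open>\<open>\<eta>\<close> is the perturbation that makes the Hankel forms strict. The
  represented radius \<open>(N + 1) * \<sigma>\<close> exceeds the radius
  \<open>N * \<sigma>\<close> of the later limit by one \<open>\<sigma>\<close>, which supplies the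
  outer second difference used for tightness.\<close>

lemma dyadic_grid_representation:
  assumes nd: "negative_definite_on S f" and \<sigma>: "\<sigma> > 0" "{m - real (N + 2) * \<sigma>..m + real (N + 2) * \<sigma>} \<subseteq> S"
  shows "\<exists>\<Lambda> \<omega> c d \<eta>. finite \<Lambda> \<and> (\<forall>l\<in>\<Lambda>. \<omega> l \<ge> 0) \<and>
     (\<forall>z::int. \<bar>z\<bar> \<le> (int (N + 1) * 2 ^ j :: int) \<longrightarrow> \<bar>\<eta> (m + z * (\<sigma> / 2 ^ j))\<bar> \<le> 1 / (real j + 1) \<and>
        f (m + z * (\<sigma> / 2 ^ j)) + \<eta> (m + z * (\<sigma> / 2 ^ j)) =
        c + d * (m + z * (\<sigma> / 2 ^ j) - m) + (\<Sum>l\<in>\<Lambda>. \<omega> l * efun m l (m + z * (\<sigma> / 2 ^ j))))"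
proof -
  define h where "h = \<sigma> / 2 ^ j"
  define n :: nat where "n = (N + 1) * 2 ^ j"
  \<comment> \<open>A grid with \<open>2 * n + 2\<close> points has one more than the symmetric
    range \<open>|z| \<le> n\<close>. The surplus point has index \<open>0\<close>, at the left end,
    whence \<open>- h\<close> here and \<open>k = z + n + 1\<close> below; it fits because
    \<open>h \<le> \<sigma>\<close>, one reason for the margin \<open>N + 2\<close>.\<close>
  define A where "A = m - real (N + 1) * \<sigma> - h"
  define \<phi> where "\<phi> t = (\<Sum>i<n. efun m (real i) t)" for t
  define C where "C = (\<Sum>k\<le>2 * n + 1. \<bar>\<phi> (A + real k * h)\<bar>)"
  \<comment> \<open>\<open>C\<close> bounds \<open>\<phi>\<close> on the finite grid, so the
    perturbation is at most \<open>1 / (j + 1)\<close> there; \<open>1 + C\<close> keeps the divisor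
    positive even if \<open>C = 0\<close>.\<close>
  define \<epsilon> where "\<epsilon> = 1 / ((real j + 1) * (1 + C))"
  have h: "h > 0" using \<sigma> by (simp add: h_def)
  have nh: "real n * h = real (N + 1) * \<sigma>"
  proof -
    have "real n = real (N + 1) * 2 ^ j" by (simp only: n_def of_nat_mult of_nat_power of_nat_numeral)
    then show ?thesis by (simp only: h_def) simp
  qed
  have "h \<le> \<sigma>" using \<sigma> by (simp add: h_def divide_le_eq)
  have C: "C \<ge> 0" unfolding C_def by (intro sum_nonneg) auto
  have eps: "\<epsilon> > 0" using C by (simp add: \<epsilon>_def)
  have "A + real k * h \<in> S" if "k \<le> 2 * n + 1" for k
  proof -
    have "real k * h \<le> real (2 * n + 1) * h" using that h by (intro mult_right_mono) auto
    also have "\<dots> = 2 * (real (N + 1) * \<sigma>) + h" using nh by (simp add: algebra_simps)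
    finally have "A + real k * h \<le> m + real (N + 1) * \<sigma>" unfolding A_def by linarith
    moreover have "A \<le> A + real k * h" using h by simp
    moreover have "real (N + 2) * \<sigma> = real (N + 1) * \<sigma> + \<sigma>" by (simp add: algebra_simps)
    ultimately have "A + real k * h \<in> {m - real (N + 2) * \<sigma>..m + real (N + 2) * \<sigma>}"
      using \<sigma>(1) \<open>h \<le> \<sigma>\<close> unfolding atLeastAtMost_iff A_def by linarith
    then show ?thesis using \<sigma>(2) by blast
  qed
  from grid_representation[where n = n and A = A and m = m, OF nd h eps this] obtain \<Lambda> \<omega> c d where
    R: "finite \<Lambda>" "\<forall>l\<in>\<Lambda>. \<omega> l \<ge> 0" "\<And>k. k \<le> 2 * n + 1 \<Longrightarrow>
       f (A + real k * h) + \<epsilon> * \<phi> (A + real k * h) =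
       c + d * (A + real k * h - m) + (\<Sum>l\<in>\<Lambda>. \<omega> l * efun m l (A + real k * h))"
    unfolding \<phi>_def by auto
  show ?thesis
  proof (rule exI[of _ \<Lambda>], rule exI[of _ \<omega>], rule exI[of _ c], rule exI[of _ d],
      rule exI[of _ "\<lambda>t. \<epsilon> * \<phi> t"], intro conjI allI impI)
    fix z :: int assume z: "\<bar>z\<bar> \<le> (int (N + 1) * 2 ^ j :: int)"
    have zn: "\<bar>z\<bar> \<le> int n" using z by (simp only: n_def of_nat_mult of_nat_power of_nat_numeral)
    define k where "k = nat (z + int n + 1)"
    have "int k = z + int n + 1" using zn by (simp add: k_def)
    then have k: "real k = of_int z + real n + 1" by (metis of_int_add of_int_1 of_int_of_nat_eq)
    have "int k \<le> int (2 * n + 1)" using zn \<open>int k = _\<close> by simp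
    then have kn: "k \<le> 2 * n + 1" by linarith
    have pt: "m + z * (\<sigma> / 2 ^ j) = A + real k * h"
      using nh by (simp add: k A_def h_def[symmetric] algebra_simps)
    have "\<bar>\<phi> (A + real k * h)\<bar> \<le> C" unfolding C_def using kn by (intro member_le_sum) auto
    then have "\<epsilon> * \<bar>\<phi> (A + real k * h)\<bar> \<le> \<epsilon> * (1 + C)" using eps by (intro mult_left_mono) auto
    also have "\<dots> = 1 / (real j + 1)" using C by (simp add: \<epsilon>_def)
    finally show "\<bar>\<epsilon> * \<phi> (m + z * (\<sigma> / 2 ^ j))\<bar> \<le> 1 / (real j + 1)"
      unfolding pt using eps by (simp add: abs_mult)
    show "f (m + z * (\<sigma> / 2 ^ j)) + \<epsilon> * \<phi> (m + z * (\<sigma> / 2 ^ j)) =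
        c + d * (m + z * (\<sigma> / 2 ^ j) - m) + (\<Sum>l\<in>\<Lambda>. \<omega> l * efun m l (m + z * (\<sigma> / 2 ^ j)))"
      unfolding pt by (rule R(3)[OF kn])
  qed (use R in auto)
qed

section \<open>Size, continuity and growth of the kernels\<close>

lemma cosh_kernel_eq_efun: "cosh_kernel s l = - (efun m l (m + s) + efun m l (m - s))"
proof -
  have "efun m l m = 0" by (simp add: efun_def)
  then show ?thesis using efun_second_difference[of m l m s] by simp
qed

lemma efun'_sign: "t \<ge> m \<Longrightarrow> efun' m l t \<le> 0" "t \<le> m \<Longrightarrow> efun' m l t \<ge> 0"
  by (auto simp: efun'_def divide_le_0_iff zero_le_divide_iff mult_le_0_iff zero_le_mult_iff not_le)

lemma efun_nonpos: "efun m l t \<le> 0"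
proof -
  have "exp (- l * (t - m)) \<ge> 1 + (- l * (t - m))" by (rule exp_ge_add_one_self)
  then show ?thesis by (simp add: efun_def divide_le_0_iff)
qed

text \<open>As a function of \<open>t\<close> the kernel rises to 0 at \<open>m\<close> and then
  falls, so its absolute value on the interval is bounded by that at an endpoint, and
  \<open>cosh_kernel s l\<close> adds both endpoint values.\<close>

lemma abs_efun_le_cosh_kernel:
  assumes "\<bar>t - m\<bar> \<le> s" shows "\<bar>efun m l t\<bar> \<le> cosh_kernel s l"
proof -
  have "efun m l (m + s) \<le> efun m l t \<or> efun m l (m - s) \<le> efun m l t"
  proof (cases "t \<ge> m")
    case True
    have "efun m l (m + s) \<le> efun m l t"
      by (rule DERIV_nonpos_imp_nonincreasing)
         (use True assms in \<open>auto intro!: exI conjI efun_has_derivative efun'_sign\<close>)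
    then show ?thesis ..
  next
    case False
    have "efun m l (m - s) \<le> efun m l t"
      by (rule DERIV_nonneg_imp_nondecreasing)
         (use False assms in \<open>auto intro!: exI conjI efun_has_derivative efun'_sign\<close>)
    then show ?thesis ..
  qed
  then show ?thesis
    using efun_nonpos[of m l t] efun_nonpos[of m l "m + s"] efun_nonpos[of m l "m - s"]
    unfolding cosh_kernel_eq_efun[of s l m] by linarith
qed

text \<open>Weak convergence needs test functions continuous in \<open>l\<close>, also at
  \<open>l = 0\<close>. The dependence on \<open>l\<close> passes through
  \<open>(exp x - 1 - x) / x^2\<close>, whose singularity is removable with value
  \<open>1 / 2\<close>.\<close>

lemma isCont_efun: "isCont (\<lambda>l. efun m l t) l"
proof -
  define E where "E x = (if x = 0 then 1 / 2 else (exp x - 1 - x) / x\<^sup>2)" for x :: real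
  have "isCont E x" for x
  proof (cases "x = 0")
    case True
    have "((\<lambda>x::real. (exp x - 1 - x) / x\<^sup>2) \<longlongrightarrow> 1 / 2) (at 0)" by real_asymp
    moreover have "(E \<longlongrightarrow> 1 / 2) (at 0) \<longleftrightarrow> ((\<lambda>x::real. (exp x - 1 - x) / x\<^sup>2) \<longlongrightarrow> 1 / 2) (at 0)"
      by (intro filterlim_cong refl) (auto simp: E_def eventually_at intro!: exI[of _ 1])
    ultimately show ?thesis using True by (simp add: isCont_def E_def)
  next
    case False
    have "isCont (\<lambda>x. (exp x - 1 - x) / x\<^sup>2) x" using False by (intro continuous_intros) auto
    moreover have "\<forall>\<^sub>F y in nhds x. E y = (exp y - 1 - y) / y\<^sup>2"
      using t1_space_nhds[OF False] by eventually_elim (simp add: E_def)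
    ultimately show ?thesis using isCont_cong[of E "\<lambda>y. (exp y - 1 - y) / y\<^sup>2" x] by simp
  qed
  then have "isCont (\<lambda>l. E (- l * (t - m))) l"
    by (intro isCont_o2[of l "\<lambda>l. - l * (t - m)" E]) (auto intro!: continuous_intros)
  then have "isCont (\<lambda>l. - ((t - m)\<^sup>2 * E (- l * (t - m)))) l"
    by (intro isCont_minus isCont_mult continuous_const)
  moreover have "efun m l t = - ((t - m)\<^sup>2 * E (- l * (t - m)))" for l
  proof (cases "t = m \<or> l = 0")
    case False
    have "(- l * (t - m))\<^sup>2 = (t - m)\<^sup>2 * l\<^sup>2" by (simp add: power_mult_distrib)
    then have "E (- l * (t - m)) = (exp (- l * (t - m)) - 1 - (- l * (t - m))) / ((t - m)\<^sup>2 * l\<^sup>2)"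
      using False by (simp add: E_def)
    then have "(t - m)\<^sup>2 * E (- l * (t - m)) = (exp (- l * (t - m)) - 1 - (- l * (t - m))) / l\<^sup>2"
      using False by simp
    then show ?thesis using False by (simp add: efun_def minus_divide_left)
  qed (auto simp: efun_def E_def)
  ultimately show ?thesis by simp
qed

lemma isCont_cosh_kernel: "isCont (cosh_kernel s) l"
proof -
  have "cosh_kernel s = (\<lambda>l. - (efun 0 l (0 + s) + efun 0 l (0 - s)))" using cosh_kernel_eq_efun[of s _ 0] by blast
  then show ?thesis by (simp only:) (intro continuous_intros isCont_efun)
qed

text \<open>With \<open>p = exp (- |l| s)\<close> and \<open>q = exp (\<sigma> |l|)\<close> the
  leading exponentials agree, and the claim becomes
  \<open>p * (q - 1 / q) \<le> 2 * (q - 1)\<close>. As \<open>p \<le> 1\<close>, this follows from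
  \<open>q + 1 / q \<ge> 2\<close>.\<close>

lemma cosh_kernel_growth:
  assumes "s > 0" "\<sigma> > 0"
  shows "cosh_kernel s l * exp (\<sigma> * \<bar>l\<bar>) \<le> cosh_kernel (s + \<sigma>) l"
proof (cases "l = 0")
  case True
  then show ?thesis using assms by (simp add: cosh_kernel_def power_mono)
next
  case False
  define p where "p = exp (- (\<bar>l\<bar> * s))"
  define q where "q = exp (\<sigma> * \<bar>l\<bar>)"
  have even: "cosh_kernel h l = (exp (\<bar>l\<bar> * h) + exp (- (\<bar>l\<bar> * h)) - 2) / l\<^sup>2" for h
    using False by (cases "l > 0") (auto simp: cosh_kernel_def add.commute)
  have q: "q \<ge> 1" using assms by (simp add: q_def)
  have p: "p \<le> 1" using assms by (simp add: p_def)
  have "exp (\<bar>l\<bar> * s) * q = exp (\<bar>l\<bar> * (s + \<sigma>))" "exp (- (\<bar>l\<bar> * (s + \<sigma>))) = p * inverse q"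
    by (simp_all add: p_def q_def mult_exp_exp algebra_simps flip: exp_minus)
  moreover have "p * q - 2 * q \<le> p * inverse q - 2"
  proof -
    have "p * (q - inverse q) \<le> 1 * (q - inverse q)"
      using p q by (intro mult_right_mono) (auto intro: order.trans[OF inverse_le_1_iff[THEN iffD2]])
    moreover have "2 \<le> q + inverse q"
      using exp_plus_exp_minus_ge[of "\<sigma> * \<bar>l\<bar>"] zero_le_power2[of "\<sigma> * \<bar>l\<bar>"]
      unfolding q_def exp_minus[symmetric] by linarith
    ultimately show ?thesis by (simp add: algebra_simps)
  qed
  ultimately have "(exp (\<bar>l\<bar> * s) + p - 2) * q \<le> exp (\<bar>l\<bar> * (s + \<sigma>)) + exp (- (\<bar>l\<bar> * (s + \<sigma>))) - 2"
    by (simp add: algebra_simps)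
  then have "(exp (\<bar>l\<bar> * s) + p - 2) * q / l\<^sup>2 \<le>
      (exp (\<bar>l\<bar> * (s + \<sigma>)) + exp (- (\<bar>l\<bar> * (s + \<sigma>))) - 2) / l\<^sup>2"
    by (rule divide_right_mono) simp
  then show ?thesis unfolding even p_def q_def by (simp only: times_divide_eq_left)
qed

text \<open>The masses weighted with \<open>cosh_kernel s\<close> are normalised to probabilities.
  Divided by this weight the kernel is a continuous function bounded by 1, so weak convergence
  applies even at the endpoints \<open>|t - m| = s\<close>. \<open>M > 0\<close> is what permits the
  normalisation.\<close>

lemma atomic_measures_compact:
  fixes \<Lambda> :: "nat \<Rightarrow> real set" and \<omega> :: "nat \<Rightarrow> real \<Rightarrow> real"
  assumes s: "s > 0" and \<sigma>: "\<sigma> > 0" and fin: "\<And>j. finite (\<Lambda> j)" and nonneg: "\<And>j l. l \<in> \<Lambda> j \<Longrightarrow> \<omega> j l \<ge> 0"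
    and M: "(\<lambda>j. \<Sum>l\<in>\<Lambda> j. \<omega> j l * cosh_kernel s l) \<longlonglongrightarrow> M" "M > 0"
    and K: "\<And>j. (\<Sum>l\<in>\<Lambda> j. \<omega> j l * cosh_kernel (s + \<sigma>) l) \<le> K"
  shows "\<exists>r \<mu>. strict_mono (r :: nat \<Rightarrow> nat) \<and> sets \<mu> = sets borel \<and> (\<forall>t. \<bar>t - m\<bar> \<le> s \<longrightarrow>
     integrable \<mu> (\<lambda>l. efun m l t * exp (- l * m)) \<and>
     (\<lambda>j. \<Sum>l\<in>\<Lambda> (r j). \<omega> (r j) l * efun m l t) \<longlonglongrightarrow> (\<integral>l. efun m l t * exp (- l * m) \<partial>\<mu>))"
proof -
  define mass where "mass j = (\<Sum>l\<in>\<Lambda> j. \<omega> j l * cosh_kernel s l)" for j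
  have g: "cosh_kernel s l > 0" for l using s by (intro cosh_kernel_pos) auto
  have massM: "mass \<longlonglongrightarrow> M" using M(1) by (simp add: mass_def[abs_def])
  then have "\<forall>\<^sub>F j in sequentially. mass j > M / 2" using M(2) by (intro order_tendstoD) auto
  then obtain N where N: "\<And>j. j \<ge> N \<Longrightarrow> mass j > M / 2" by (auto simp: eventually_sequentially)
  \<comment> \<open>The offset \<open>N\<close> skips the indices whose mass might be too small to
    divide by; afterwards it exceeds \<open>M / 2\<close>.\<close>
  define p where "p j l = \<omega> (j + N) l * cosh_kernel s l / mass (j + N)" for j l
  have mass_pos: "mass (j + N) > M / 2" "mass (j + N) > 0" for j using N[of "j + N"] M(2) by auto
  have p_nonneg: "p j l \<ge> 0" if "l \<in> \<Lambda> (j + N)" for j l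
    unfolding p_def using nonneg[OF that] g mass_pos(2) by (simp add: less_imp_le)
  have p_sum: "(\<Sum>l\<in>\<Lambda> (j + N). p j l) = 1" for j
    using mass_pos(2)[of j] unfolding p_def sum_divide_distrib[symmetric] mass_def by simp
  define P where "P j = distr (point_measure (\<Lambda> (j + N)) (\<lambda>l. ennreal (p j l))) borel (\<lambda>l. l)" for j
  have prob: "real_distribution (P j)" for j
  proof -
    have "prob_space (point_measure (\<Lambda> (j + N)) (\<lambda>l. ennreal (p j l)))"
    proof (rule prob_spaceI)
      show "emeasure (point_measure (\<Lambda> (j + N)) (\<lambda>l. ennreal (p j l)))
          (space (point_measure (\<Lambda> (j + N)) (\<lambda>l. ennreal (p j l)))) = 1"
        unfolding space_point_measure using fin p_nonneg p_sum
        by (subst emeasure_point_measure_finite) (auto simp: sum_ennreal)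
    qed
    then interpret prob_space "point_measure (\<Lambda> (j + N)) (\<lambda>l. ennreal (p j l))" .
    show ?thesis unfolding P_def by (rule real_distribution_distr) (simp add: measurable_def space_point_measure sets_point_measure)
  qed
  have P_integral: "(\<integral>l. F l \<partial>P j) = (\<Sum>l\<in>\<Lambda> (j + N). p j l * F l)" if "F \<in> borel_measurable borel"
    for F :: "real \<Rightarrow> real" and j
    unfolding P_def using that fin p_nonneg
    by (subst integral_distr)
       (auto simp: lebesgue_integral_point_measure_finite measurable_def space_point_measure sets_point_measure)
  have "tight P"
    unfolding tight_def
  proof (intro conjI allI impI prob)
    fix \<epsilon> :: real assume eps: "\<epsilon> > 0"
    \<comment> \<open>\<open>K'\<close> bounds the mean of \<open>\<sigma> |l|\<close> under all
      \<open>P j\<close>, because the normalising masses exceed \<open>M / 2\<close>. The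
      \<open>+ 1\<close> in \<open>R\<close> makes the tail bound strictly smaller than
      \<open>\<epsilon>\<close>.\<close>
    define K' where "K' = \<bar>K\<bar> / (M / 2)"
    define R where "R = (K' + 1) / (\<sigma> * \<epsilon>)"
    have K': "K' \<ge> 0" using M(2) by (simp add: K'_def)
    then have R: "R > 0" using eps \<sigma> by (simp add: R_def)
    have first_moment: "(\<Sum>l\<in>\<Lambda> (j + N). p j l * (\<sigma> * \<bar>l\<bar>)) \<le> K'" for j
    proof -
      have "(\<Sum>l\<in>\<Lambda> (j + N). p j l * (\<sigma> * \<bar>l\<bar>)) \<le>
          (\<Sum>l\<in>\<Lambda> (j + N). \<omega> (j + N) l * cosh_kernel (s + \<sigma>) l / mass (j + N))"
      proof (rule sum_mono)
        fix l assume l: "l \<in> \<Lambda> (j + N)"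
        have "\<sigma> * \<bar>l\<bar> \<le> exp (\<sigma> * \<bar>l\<bar>)" using exp_ge_add_one_self[of "\<sigma> * \<bar>l\<bar>"] by linarith
        then have "\<sigma> * \<bar>l\<bar> * cosh_kernel s l \<le> exp (\<sigma> * \<bar>l\<bar>) * cosh_kernel s l"
          using g[of l] by (intro mult_right_mono) auto
        also have "\<dots> \<le> cosh_kernel (s + \<sigma>) l"
          using cosh_kernel_growth[OF s \<sigma>, of l] by (simp add: mult.commute)
        finally have "\<omega> (j + N) l * (\<sigma> * \<bar>l\<bar> * cosh_kernel s l) / mass (j + N) \<le>
            \<omega> (j + N) l * cosh_kernel (s + \<sigma>) l / mass (j + N)"
          using nonneg[OF l] mass_pos(2)[of j]
          by (intro divide_right_mono mult_left_mono) auto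
        then show "p j l * (\<sigma> * \<bar>l\<bar>) \<le> \<omega> (j + N) l * cosh_kernel (s + \<sigma>) l / mass (j + N)"
          by (simp add: p_def mult_ac)
      qed
      also have "\<dots> \<le> \<bar>K\<bar> / mass (j + N)"
        unfolding sum_divide_distrib[symmetric]
        using K[of "j + N"] mass_pos(2)[of j] by (intro divide_right_mono) auto
      also have "\<dots> \<le> K'"
        unfolding K'_def using mass_pos[of j] M(2) by (intro divide_left_mono) auto
      finally show ?thesis .
    qed
    show "\<exists>a b. a < b \<and> (\<forall>j. 1 - \<epsilon> < measure (P j) {a<..b})"
    proof (rule exI[of _ "- R"], rule exI[of _ R], intro conjI allI)
      show "- R < R" using R by simp
      fix j
      interpret real_distribution "P j" by (rule prob)
      have "1 - 1 / (\<sigma> * R) * (\<Sum>l\<in>\<Lambda> (j + N). p j l * (\<sigma> * \<bar>l\<bar>)) =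
          (\<Sum>l\<in>\<Lambda> (j + N). p j l * (1 - \<bar>l\<bar> / R))"
        using \<sigma> p_sum[of j] by (simp add: right_diff_distrib sum_subtractf sum_distrib_left)
      \<comment> \<open>Markov's inequality in the form
        \<open>1 - |l| / R \<le> indicator {-R<..R} l\<close>.\<close>
      also have "\<dots> \<le> (\<Sum>l\<in>\<Lambda> (j + N). p j l * indicator {-R<..R} l)"
        using R by (intro sum_mono mult_left_mono p_nonneg)
          (auto simp: indicator_def le_divide_eq)
      also have "\<dots> = (\<integral>l. indicator {-R<..R} l \<partial>P j)"
        by (rule P_integral[symmetric]) simp
      also have "\<dots> = measure (P j) {-R<..R}"
        by (simp add: Bochner_Integration.integral_indicator)
      finally have "1 - 1 / (\<sigma> * R) * (\<Sum>l\<in>\<Lambda> (j + N). p j l * (\<sigma> * \<bar>l\<bar>)) \<le> measure (P j) {-R<..R}" .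
      moreover have "1 / (\<sigma> * R) * (\<Sum>l\<in>\<Lambda> (j + N). p j l * (\<sigma> * \<bar>l\<bar>)) \<le> 1 / (\<sigma> * R) * K'"
        using \<sigma> R by (intro mult_left_mono first_moment) auto
      moreover have "1 / (\<sigma> * R) * K' = \<epsilon> * (K' / (K' + 1))" using \<sigma> eps by (simp add: R_def)
      moreover have "\<epsilon> * (K' / (K' + 1)) < \<epsilon> * 1"
        using eps K' by (intro mult_strict_left_mono) auto
      ultimately show "1 - \<epsilon> < measure (P j) {-R<..R}" by linarith
    qed
  qed
  then obtain r Q where r: "strict_mono r" and Q: "real_distribution Q" and conv: "weak_conv_m (P \<circ> id \<circ> r) Q"
    using tight_imp_convergent_subsubsequence[of P id] by (auto simp: strict_mono_def)
  interpret Q: real_distribution Q by (rule Q)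
  \<comment> \<open>\<open>M\<close> restores the total mass, the division undoes the weighting of
    the atoms, and \<open>exp (l * m)\<close> cancels the factor \<open>exp (- l * m)\<close> of the
    representation.\<close>
  define \<mu> where "\<mu> = density Q (\<lambda>l. ennreal (M / cosh_kernel s l * exp (l * m)))"
  have gmeas [measurable]: "cosh_kernel s \<in> borel_measurable borel"
    by (intro borel_measurable_continuous_onI continuous_at_imp_continuous_on ballI isCont_cosh_kernel)
  show ?thesis
  proof (intro exI[of _ "\<lambda>j. r j + N"] exI[of _ \<mu>] conjI allI impI)
    show "strict_mono (\<lambda>j. r j + N)" using r by (simp add: strict_mono_def)
    show "sets \<mu> = sets borel" by (simp add: \<mu>_def)
    fix t assume t: "\<bar>t - m\<bar> \<le> s"
    define F where "F l = efun m l t / cosh_kernel s l" for l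
    have F_le: "\<bar>F l\<bar> \<le> 1" for l
      using abs_efun_le_cosh_kernel[OF t, of l] g[of l] by (simp add: F_def abs_divide)
    have F_cont: "isCont F l" for l
      unfolding F_def[abs_def] using g[of l]
      by (intro isCont_divide isCont_efun isCont_cosh_kernel) auto
    have F_meas [measurable]: "F \<in> borel_measurable borel" unfolding F_def[abs_def] by measurable
    have dens: "M / cosh_kernel s l * exp (l * m) * (efun m l t * exp (- l * m)) = M * F l" for l
      using mult_exp_exp[of "l * m" "- l * m"] by (simp add: F_def)
    have dens_nonneg: "0 \<le> M / cosh_kernel s l * exp (l * m)" for l using M(2) g[of l] by (simp add: less_imp_le)
    have "integrable Q F" using F_le by (intro Q.integrable_const_bound[of _ 1]) auto
    then have "integrable Q (\<lambda>l. M / cosh_kernel s l * exp (l * m) * (efun m l t * exp (- l * m)))"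
      unfolding dens by simp
    then show "integrable \<mu> (\<lambda>l. efun m l t * exp (- l * m))"
      unfolding \<mu>_def using dens_nonneg by (subst integrable_density) auto
    have "(\<integral>l. efun m l t * exp (- l * m) \<partial>\<mu>) =
        (\<integral>l. M / cosh_kernel s l * exp (l * m) * (efun m l t * exp (- l * m)) \<partial>Q)"
      unfolding \<mu>_def using dens_nonneg by (subst integral_density) auto
    also have "\<dots> = M * (\<integral>l. F l \<partial>Q)" unfolding dens by simp
    finally have lim: "(\<integral>l. efun m l t * exp (- l * m) \<partial>\<mu>) = M * (\<integral>l. F l \<partial>Q)" .
    have "(\<lambda>j. \<integral>l. F l \<partial>((P \<circ> id \<circ> r) j)) \<longlonglongrightarrow> (\<integral>l. F l \<partial>Q)"
      by (rule weak_conv_imp_integral_bdd_continuous_conv[OF _ Q conv F_cont])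
         (use prob F_le in auto)
    then have "(\<lambda>j. mass (r j + N) * (\<integral>l. F l \<partial>P (r j))) \<longlonglongrightarrow> M * (\<integral>l. F l \<partial>Q)"
      using LIMSEQ_subseq_LIMSEQ[OF LIMSEQ_ignore_initial_segment[OF massM, of N] r]
      by (intro tendsto_mult) (simp_all add: o_def)
    moreover have "mass (r j + N) * (\<integral>l. F l \<partial>P (r j)) = (\<Sum>l\<in>\<Lambda> (r j + N). \<omega> (r j + N) l * efun m l t)" for j
      unfolding P_integral[OF F_meas] unfolding sum_distrib_left p_def F_def
      by (intro sum.cong refl) (use mass_pos(2)[of "r j"] g in \<open>simp add: less_imp_neq[symmetric]\<close>)
    ultimately show "(\<lambda>j. \<Sum>l\<in>\<Lambda> (r j + N). \<omega> (r j + N) l * efun m l t) \<longlonglongrightarrow>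
        (\<integral>l. efun m l t * exp (- l * m) \<partial>\<mu>)" unfolding lim by simp
  qed
qed

text \<open>The points \<open>m\<close>, \<open>m \<plusminus> s\<close> and
  \<open>m \<plusminus> (s + \<sigma>)\<close> lie on every dyadic grid, so the masses of radius
  \<open>s\<close> and \<open>s + \<sigma>\<close> are known for all \<open>j\<close> up to the
  vanishing perturbation.\<close>

lemma local_levy_khinchin_rep:
  assumes nd: "negative_definite_on S f" and cont: "continuous_on S f" and \<sigma>: "\<sigma> > 0" and N: "N > 0"
    and sub: "{m - real (N + 2) * \<sigma>..m + real (N + 2) * \<sigma>} \<subseteq> S"
  defines "s \<equiv> real N * \<sigma>"
  shows "\<exists>\<mu> c d. sets \<mu> = sets borel \<and> levy_khinchin_rep {m - s<..<m + s} m f c d \<mu>"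
proof -
  have s: "s > 0" using \<sigma> N by (simp add: s_def)
  define pt where "pt j z = m + of_int z * (\<sigma> / 2 ^ j)" for j :: nat and z :: int
  define R where "R j \<Lambda> \<omega> c d \<eta> \<longleftrightarrow> finite \<Lambda> \<and> (\<forall>l\<in>\<Lambda>. \<omega> l \<ge> 0) \<and>
     (\<forall>z. \<bar>z\<bar> \<le> int (N + 1) * 2 ^ j \<longrightarrow> \<bar>\<eta> (pt j z)\<bar> \<le> 1 / (real j + 1) \<and>
        f (pt j z) + \<eta> (pt j z) =
        c + d * (pt j z - m) + (\<Sum>l\<in>\<Lambda>. \<omega> l * efun m l (pt j z)))"
    for j \<Lambda> \<omega> c d \<eta>
  have "\<exists>\<Lambda> \<omega> c d \<eta>. R j \<Lambda> \<omega> c d \<eta>" for j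
    using dyadic_grid_representation[OF nd \<sigma> sub, of j] unfolding R_def pt_def .
  then obtain \<Lambda> \<omega> c d \<eta> where R: "\<And>j. R j (\<Lambda> j) (\<omega> j) (c j) (d j) (\<eta> j)" by metis
  define I where "I j t = (\<Sum>l\<in>\<Lambda> j. \<omega> j l * efun m l t)" for j t
  define G where "G j t \<longleftrightarrow> (\<exists>z. \<bar>z\<bar> \<le> int (N + 1) * 2 ^ j \<and> t = pt j z)" for j t
  have fin: "finite (\<Lambda> j)" and nonneg: "l \<in> \<Lambda> j \<Longrightarrow> \<omega> j l \<ge> 0" for j l
    using R by (auto simp: R_def)
  have grid: "f t + \<eta> j t = c j + d j * (t - m) + I j t" and small: "\<bar>\<eta> j t\<bar> \<le> 1 / (real j + 1)"
    if "G j t" for j t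
    using R[of j] that unfolding R_def G_def I_def by auto
  have Gm: "G j m" for j unfolding G_def by (intro exI[of _ 0]) (simp add: pt_def)
  have G_mult: "G j (m + k * \<sigma>)" if "\<bar>k\<bar> \<le> int (N + 1)" for j and k :: int
    unfolding G_def
  proof (intro exI[of _ "k * 2 ^ j"] conjI)
    show "\<bar>k * 2 ^ j\<bar> \<le> int (N + 1) * 2 ^ j"
      using that by (simp only: abs_mult) (intro mult_mono, auto)
  qed (simp add: pt_def)
  have Gs: "G j (m + s)" "G j (m - s)" "G j (m + (s + \<sigma>))" "G j (m - (s + \<sigma>))" for j
    using G_mult[of "int N" j] G_mult[of "- int N" j] G_mult[of "int (N + 1)" j] G_mult[of "- int (N + 1)" j]
    by (simp_all add: s_def algebra_simps)
  have \<eta>_lim: "(\<lambda>j. \<eta> j t) \<longlonglongrightarrow> 0" if "\<forall>\<^sub>F j in sequentially. G j t" for t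
  proof (rule Lim_null_comparison)
    show "\<forall>\<^sub>F j in sequentially. norm (\<eta> j t) \<le> 1 / (real j + 1)"
      using that by eventually_elim (simp add: small)
    show "(\<lambda>j. 1 / (real j + 1)) \<longlonglongrightarrow> 0" by real_asymp
  qed
  have efun0: "efun m l m = 0" for l by (simp add: efun_def)
  have c: "c j = f m + \<eta> j m" for j using grid[OF Gm, of j] by (simp add: I_def efun0)
  have c_lim: "c \<longlonglongrightarrow> f m"
    unfolding c[abs_def] using tendsto_add[OF tendsto_const \<eta>_lim, of m "f m"] Gm by simp
  have mass: "(\<Sum>l\<in>\<Lambda> j. \<omega> j l * cosh_kernel u l) =
      2 * c j - (f (m + u) + \<eta> j (m + u)) - (f (m - u) + \<eta> j (m - u))"
    if "G j (m + u)" "G j (m - u)" for j u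
  proof -
    have "(\<Sum>l\<in>\<Lambda> j. \<omega> j l * cosh_kernel u l) = - (I j (m + u) + I j (m - u))"
      unfolding I_def cosh_kernel_eq_efun[of u _ m] sum.distrib[symmetric] sum_negf[symmetric]
      by (intro sum.cong refl) (simp add: algebra_simps)
    then show ?thesis using grid[OF that(1)] grid[OF that(2)] by (simp add: algebra_simps)
  qed
  define M where "M = 2 * f m - f (m + s) - f (m - s)"
  have mass_lim: "(\<lambda>j. \<Sum>l\<in>\<Lambda> j. \<omega> j l * cosh_kernel s l) \<longlonglongrightarrow> M"
  proof -
    have "(\<lambda>j. 2 * c j - (f (m + s) + \<eta> j (m + s)) - (f (m - s) + \<eta> j (m - s))) \<longlonglongrightarrow>
        2 * f m - (f (m + s) + 0) - (f (m - s) + 0)"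
      using Gs by (intro tendsto_intros c_lim \<eta>_lim) auto
    then show ?thesis using Gs by (simp add: mass M_def)
  qed
  have mass_nonneg: "(\<Sum>l\<in>\<Lambda> j. \<omega> j l * cosh_kernel s l) \<ge> 0" for j
    using nonneg cosh_kernel_pos[of s] s by (intro sum_nonneg mult_nonneg_nonneg) (auto intro: less_imp_le)
  \<comment> \<open>The \<open>4\<close> collects the perturbations, each at most 1: two copies at
    \<open>m\<close> and one at each outer point.\<close>
  have outer: "(\<Sum>l\<in>\<Lambda> j. \<omega> j l * cosh_kernel (s + \<sigma>) l) \<le> 2 * f m - f (m + (s + \<sigma>)) - f (m - (s + \<sigma>)) + 4" for j
  proof -
    have "1 / (real j + 1) \<le> 1" by simp
    then have "\<bar>\<eta> j m\<bar> \<le> 1" "\<bar>\<eta> j (m + (s + \<sigma>))\<bar> \<le> 1" "\<bar>\<eta> j (m - (s + \<sigma>))\<bar> \<le> 1"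
      using small[OF Gm, of j] small[OF Gs(3), of j] small[OF Gs(4), of j] by linarith+
    then have "\<eta> j m \<le> 1" "- \<eta> j (m + (s + \<sigma>)) \<le> 1" "- \<eta> j (m - (s + \<sigma>)) \<le> 1"
      by (simp_all only: abs_le_iff)
    then show ?thesis unfolding mass[OF Gs(3,4)] c distrib_left by linarith
  qed
  have "M \<ge> 0" using mass_lim mass_nonneg by (intro LIMSEQ_le_const) auto
  have "\<exists>r \<mu>. strict_mono (r :: nat \<Rightarrow> nat) \<and> sets \<mu> = sets borel \<and> (\<forall>t. \<bar>t - m\<bar> \<le> s \<longrightarrow>
     integrable \<mu> (\<lambda>l. efun m l t * exp (- l * m)) \<and>
     (\<lambda>j. I (r j) t) \<longlonglongrightarrow> (\<integral>l. efun m l t * exp (- l * m) \<partial>\<mu>))"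
  \<comment> \<open>For \<open>M = 0\<close> the weighted masses tend to 0 and drag every atomic sum
    with them, so the null measure is the limit.\<close>
  proof (cases "M = 0")
    case True
    have I_lim: "(\<lambda>j. I j t) \<longlonglongrightarrow> 0" if t: "\<bar>t - m\<bar> \<le> s" for t
    proof (rule Lim_null_comparison)
      show "(\<lambda>j. \<Sum>l\<in>\<Lambda> j. \<omega> j l * cosh_kernel s l) \<longlonglongrightarrow> 0" using mass_lim True by simp
      have "\<bar>I j t\<bar> \<le> (\<Sum>l\<in>\<Lambda> j. \<bar>\<omega> j l * efun m l t\<bar>)" for j unfolding I_def by (rule sum_abs)
      also have "\<dots> j \<le> (\<Sum>l\<in>\<Lambda> j. \<omega> j l * cosh_kernel s l)" for j
        using nonneg abs_efun_le_cosh_kernel[OF t] by (intro sum_mono) (simp add: abs_mult mult_left_mono)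
      finally show "\<forall>\<^sub>F j in sequentially. norm (I j t) \<le> (\<Sum>l\<in>\<Lambda> j. \<omega> j l * cosh_kernel s l)" by simp
    qed
    show ?thesis
    proof (intro exI[of _ id] exI[of _ "density borel (\<lambda>_. 0)"] conjI allI impI)
      fix t assume t: "\<bar>t - m\<bar> \<le> s"
      have *: "integrable (density borel (\<lambda>_. ennreal 0)) (\<lambda>l. efun m l t * exp (- l * m))"
        by (subst integrable_density) auto
      have **: "(\<integral>l. efun m l t * exp (- l * m) \<partial>density borel (\<lambda>_. ennreal 0)) = 0"
        by (subst integral_density) auto
      show "integrable (density borel (\<lambda>_. 0)) (\<lambda>l. efun m l t * exp (- l * m))" using * by simp
      show "(\<lambda>j. I (id j) t) \<longlonglongrightarrow> (\<integral>l. efun m l t * exp (- l * m) \<partial>density borel (\<lambda>_. 0))"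
        using ** I_lim[OF t] by simp
    qed (auto simp: strict_mono_def)
  next
    case False
    then have "M > 0" using \<open>M \<ge> 0\<close> by simp
    from atomic_measures_compact[OF s \<sigma> fin nonneg mass_lim this outer, of m]
    show ?thesis unfolding I_def .
  qed
  then obtain r \<mu> where r: "strict_mono (r :: nat \<Rightarrow> nat)" and sets: "sets \<mu> = sets borel"
    and int: "\<And>t. \<bar>t - m\<bar> \<le> s \<Longrightarrow> integrable \<mu> (\<lambda>l. efun m l t * exp (- l * m))"
    and I_lim: "\<And>t. \<bar>t - m\<bar> \<le> s \<Longrightarrow> (\<lambda>j. I (r j) t) \<longlonglongrightarrow> (\<integral>l. efun m l t * exp (- l * m) \<partial>\<mu>)"
    by blast
  define \<Phi> where "\<Phi> t = (\<integral>l. efun m l t * exp (- l * m) \<partial>\<mu>)" for t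
  have I_lim: "(\<lambda>j. I (r j) t) \<longlonglongrightarrow> \<Phi> t" if "\<bar>t - m\<bar> \<le> s" for t
    using I_lim[OF that] by (simp add: \<Phi>_def)
  have r_filter: "filterlim r sequentially sequentially" using r by (rule filterlim_subseq)
  have c_lim': "(\<lambda>j. c (r j)) \<longlonglongrightarrow> f m" by (rule filterlim_compose[OF c_lim r_filter])
  have \<eta>_lim': "(\<lambda>j. \<eta> (r j) t) \<longlonglongrightarrow> 0" if "\<forall>\<^sub>F j in sequentially. G j t" for t
    by (rule filterlim_compose[OF \<eta>_lim[OF that] r_filter])
  \<comment> \<open>The slopes are not bounded a priori. They converge because the grid identity at
    \<open>m + s\<close> can be solved for them, which uses convergence of the atomic sums at the
    closed endpoint.\<close>
  define D where "D = (f (m + s) - f m - \<Phi> (m + s)) / s"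
  have d_lim: "(\<lambda>j. d (r j)) \<longlonglongrightarrow> D"
  proof -
    have "d (r j) = (f (m + s) + \<eta> (r j) (m + s) - c (r j) - I (r j) (m + s)) / s" for j
      using grid[OF Gs(1), of "r j"] s by (simp add: field_simps)
    moreover have "(\<lambda>j. (f (m + s) + \<eta> (r j) (m + s) - c (r j) - I (r j) (m + s)) / s) \<longlonglongrightarrow>
        (f (m + s) + 0 - f m - \<Phi> (m + s)) / s"
      using Gs s by (intro tendsto_intros c_lim' \<eta>_lim' I_lim) auto
    ultimately show ?thesis by (simp add: D_def)
  qed
  define H where "H t = f m + D * (t - m) + \<Phi> t" for t
  have grid_eq: "f t = H t" if "\<forall>\<^sub>F j in sequentially. G j t" "\<bar>t - m\<bar> \<le> s" for t
  proof (rule LIMSEQ_unique)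
    have "(\<lambda>j. f t + \<eta> (r j) t) \<longlonglongrightarrow> f t + 0"
      by (intro tendsto_intros \<eta>_lim' that)
    then show "(\<lambda>j. f t + \<eta> (r j) t) \<longlonglongrightarrow> f t" by simp
    have "(\<lambda>j. c (r j) + d (r j) * (t - m) + I (r j) t) \<longlonglongrightarrow> H t"
      unfolding H_def by (intro tendsto_intros c_lim' d_lim I_lim that)
    moreover have "\<forall>\<^sub>F j in sequentially. G (r j) t"
      by (rule eventually_compose_filterlim[OF that(1) r_filter])
    then have "\<forall>\<^sub>F j in sequentially. c (r j) + d (r j) * (t - m) + I (r j) t = f t + \<eta> (r j) t"
      by eventually_elim (simp add: grid)
    ultimately show "(\<lambda>j. f t + \<eta> (r j) t) \<longlonglongrightarrow> H t" by (rule Lim_transform_eventually)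
  qed
  let ?J = "{m - s<..<m + s}"
  \<comment> \<open>\<open>\<Phi>\<close> is itself a represented function, with zero affine part,
    so the derivative formulas make it continuous.\<close>
  have "levy_khinchin_rep ?J m \<Phi> 0 0 \<mu>"
    using int by (auto simp: levy_khinchin_rep_def \<Phi>_def abs_le_iff)
  then have \<Phi>_cont: "isCont \<Phi> t" if "t \<in> ?J" for t
    by (rule DERIV_isCont[OF levy_khinchin_rep_derivatives(3)[OF sets]]) (use that s in auto)
  have "f t = H t" if t: "t \<in> ?J" for t
  proof -
    define u where "u = (t - m) / \<sigma>"
    have t_u: "t = m + u * \<sigma>" using \<sigma> by (simp add: u_def)
    have u: "\<bar>u\<bar> \<le> real N" using t \<sigma> by (auto simp: u_def s_def abs_le_iff field_simps)
    \<comment> \<open>Rounding down at level \<open>i\<close> gives dyadic points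
      \<open>T i\<close>, which lie on all finer grids. They stay within distance \<open>s\<close>
      of \<open>m\<close> because the bounds \<open>- N * 2 ^ i\<close> and \<open>N * 2 ^ i\<close>
      are integers.\<close>
    define z where "z i = \<lfloor>u * 2 ^ i\<rfloor>" for i :: nat
    define T where "T i = pt i (z i)" for i
    have z_le: "\<bar>z i\<bar> \<le> int N * 2 ^ i" for i
    proof -
      have "u * 2 ^ i \<le> real N * 2 ^ i" "- real N * 2 ^ i \<le> u * 2 ^ i"
        using u by (intro mult_right_mono; simp add: abs_le_iff)+
      moreover have "of_int (z i) \<le> u * 2 ^ i" "u * 2 ^ i < of_int (z i) + 1"
        unfolding z_def by linarith+
      moreover have "real_of_int (int N * 2 ^ i) = real N * 2 ^ i" by simp
      ultimately have "real_of_int (z i) \<le> real_of_int (int N * 2 ^ i)"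
        "real_of_int (- (int N * 2 ^ i)) < real_of_int (z i + 1)"
        by (simp_all only: of_int_minus of_int_add of_int_1)
      then show ?thesis unfolding of_int_le_iff of_int_less_iff by linarith
    qed
    have T_near: "\<bar>T i - m\<bar> \<le> s" for i
    proof -
      have "real_of_int \<bar>z i\<bar> \<le> real_of_int (int N * 2 ^ i)" using z_le[of i] by (simp only: of_int_le_iff)
      then have "\<bar>real_of_int (z i)\<bar> * (\<sigma> / 2 ^ i) \<le> real N * 2 ^ i * (\<sigma> / 2 ^ i)"
        using \<sigma> by (intro mult_right_mono) auto
      then show ?thesis using \<sigma> by (simp add: T_def pt_def s_def abs_mult)
    qed
    have T_grid: "G j (T i)" if "j \<ge> i" for i j
      unfolding G_def
    proof (intro exI[of _ "z i * 2 ^ (j - i)"] conjI)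
      have "\<bar>z i * 2 ^ (j - i)\<bar> = \<bar>z i\<bar> * 2 ^ (j - i)" by (simp add: abs_mult)
      also have "\<dots> \<le> int N * 2 ^ i * 2 ^ (j - i)" by (intro mult_right_mono z_le) auto
      also have "\<dots> = int N * 2 ^ j" using that by (simp add: mult.assoc flip: power_add)
      also have "\<dots> \<le> int (N + 1) * 2 ^ j" by simp
      finally show "\<bar>z i * 2 ^ (j - i)\<bar> \<le> int (N + 1) * 2 ^ j" .
      have "(2::real) ^ j = 2 ^ i * 2 ^ (j - i)" using that by (simp flip: power_add)
      then show "T i = pt j (z i * 2 ^ (j - i))" by (simp add: T_def pt_def)
    qed
    have T_eq: "f (T i) = H (T i)" for i
      using T_grid T_near by (intro grid_eq) (auto simp: eventually_sequentially)
    have T_lim: "T \<longlonglongrightarrow> t"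
    proof (rule LIM_zero_cancel, rule Lim_null_comparison)
      show "\<forall>\<^sub>F i in sequentially. norm (T i - t) \<le> \<sigma> / 2 ^ i"
      proof (intro always_eventually allI)
        fix i
        have "T i - t = (of_int (z i) - u * 2 ^ i) * (\<sigma> / 2 ^ i)"
          by (simp add: T_def pt_def t_u field_simps)
        moreover have "\<bar>of_int (z i) - u * 2 ^ i\<bar> \<le> 1" unfolding z_def by linarith
        then have "\<bar>of_int (z i) - u * 2 ^ i\<bar> * (\<sigma> / 2 ^ i) \<le> 1 * (\<sigma> / 2 ^ i)"
          using \<sigma> by (intro mult_right_mono) auto
        ultimately show "norm (T i - t) \<le> \<sigma> / 2 ^ i" using \<sigma> by (simp add: abs_mult)
      qed
      show "(\<lambda>i. \<sigma> / 2 ^ i) \<longlonglongrightarrow> 0" by real_asymp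
    qed
    have inS: "y \<in> S" if "\<bar>y - m\<bar> \<le> s" for y
    proof -
      have "s \<le> real (N + 2) * \<sigma>" using \<sigma> by (simp add: s_def)
      then show ?thesis using that by (intro subsetD[OF sub]) (auto simp: abs_le_iff)
    qed
    have "t \<in> S" using t by (intro inS) (auto simp: abs_le_iff)
    \<comment> \<open>Here continuity of \<open>f\<close> enters: the grids see only dyadic
      points.\<close>
    then have "(\<lambda>i. f (T i)) \<longlonglongrightarrow> f t"
      using continuous_on_tendsto_compose[OF cont T_lim] inS T_near by simp
    moreover have "isCont H t" unfolding H_def[abs_def] by (intro continuous_intros \<Phi>_cont t)
    then have "(\<lambda>i. H (T i)) \<longlonglongrightarrow> H t" using T_lim by (rule isCont_tendsto_compose)
    ultimately show ?thesis unfolding T_eq by (rule LIMSEQ_unique)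
  qed
  then have fH: "\<And>t. t \<in> ?J \<Longrightarrow> f t = f m + D * (t - m) + (\<integral>l. efun m l t * exp (- l * m) \<partial>\<mu>)"
    unfolding H_def \<Phi>_def .
  have "levy_khinchin_rep ?J m f (f m) D \<mu>"
    unfolding levy_khinchin_rep_def
  proof (intro ballI conjI)
    fix t assume t: "t \<in> ?J"
    then have "\<bar>t - m\<bar> \<le> s" by (simp add: abs_le_iff)
    then show "integrable \<mu> (\<lambda>l. efun m l t * exp (- l * m))" by (rule int)
    show "f t = f m + D * (t - m) + (\<integral>l. efun m l t * exp (- l * m) \<partial>\<mu>)" by (rule fH[OF t])
  qed
  then show ?thesis using sets by blast
qed

subsection \<open>The representation theorem\<close>

lemma levy_khinchin_rep_subset:
  "levy_khinchin_rep S m \<psi> c d \<mu> \<Longrightarrow> T \<subseteq> S \<Longrightarrow> levy_khinchin_rep T m \<psi> c d \<mu>"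
  unfolding levy_khinchin_rep_def by blast

lemma laplace_uniqueness_open:
  fixes \<mu> \<nu> :: "real measure"
  assumes "sets \<mu> = sets borel" "sets \<nu> = sets borel" "open U" "x \<in> U"
    and "\<And>t. t \<in> U \<Longrightarrow> integrable \<mu> (\<lambda>l. exp (- l * t))"
    and "\<And>t. t \<in> U \<Longrightarrow> integrable \<nu> (\<lambda>l. exp (- l * t))"
    and "\<And>t. t \<in> U \<Longrightarrow> (\<integral>l. exp (- l * t) \<partial>\<mu>) = (\<integral>l. exp (- l * t) \<partial>\<nu>)"
  shows "\<mu> = \<nu>"
proof -
  obtain \<delta> where \<delta>: "\<delta> > 0" "{x - 2 * \<delta>..x + 2 * \<delta>} \<subseteq> U"
    using interval_in_open[OF assms(3,4)] by blast
  then have sub: "{x - \<delta><..<x + \<delta>} \<subseteq> U" by (auto simp: subset_iff)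
  show ?thesis
    by (rule laplace_uniqueness[of _ _ "x - \<delta>" "x + \<delta>"])
       (use assms sub \<delta> in \<open>auto simp: subset_iff\<close>)
qed

text \<open>Local representations live on intervals symmetric about their base point, while
  \<open>S\<close> may be unbounded or lopsided about \<open>t0\<close>. Each \<open>t\<close> is
  reached from the midpoint of \<open>t0\<close> and \<open>t\<close>, and the base is then moved to
  \<open>t0\<close>. There \<open>c\<close> and \<open>d\<close> are the value and slope of
  \<open>\<psi>\<close>, the same for all local representations.\<close>

lemma negative_definite_imp_levy_khinchin_rep:
  assumes S: "open S" "convex S" "t0 \<in> S"
    and nd: "negative_definite_on S \<psi>" and cont: "continuous_on S \<psi>"
  shows "\<exists>\<mu> c d. sets \<mu> = sets borel \<and> levy_khinchin_rep S t0 \<psi> c d \<mu>"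
proof -
  have nearby: "\<exists>U \<mu> c d. open U \<and> t0 \<in> U \<and> t \<in> U \<and> sets \<mu> = sets borel \<and>
      levy_khinchin_rep U t0 \<psi> c d \<mu>" if t: "t \<in> S" for t
  proof -
    define m where "m = (t0 + t) / 2"
    define w where "w = \<bar>t - t0\<bar> / 2"
    have ends: "m - w = min t0 t" "m + w = max t0 t" by (auto simp: m_def w_def min_def max_def field_simps)
    obtain e1 where e1: "e1 > 0" "{m - w - 2 * e1..m - w + 2 * e1} \<subseteq> S"
      using interval_in_open[OF S(1), of "m - w"] S(3) t unfolding ends by (metis min_def)
    obtain e2 where e2: "e2 > 0" "{m + w - 2 * e2..m + w + 2 * e2} \<subseteq> S"
      using interval_in_open[OF S(1), of "m + w"] S(3) t unfolding ends by (metis max_def)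
    \<comment> \<open>\<open>N * \<sigma>\<close> exceeds \<open>w\<close> by at most one step, and
      the local result asks for room for two more, which makes
      \<open>w + 3 * \<sigma> = w + min e1 e2\<close>.\<close>
    define \<sigma> where "\<sigma> = min e1 e2 / 3"
    have \<sigma>: "\<sigma> > 0" using e1 e2 by (simp add: \<sigma>_def)
    define N where "N = nat \<lfloor>w / \<sigma>\<rfloor> + 1"
    have w0: "w \<ge> 0" by (simp add: w_def)
    have "real N = of_int \<lfloor>w / \<sigma>\<rfloor> + 1" using w0 \<sigma> by (simp add: N_def)
    then have "w / \<sigma> < real N" "real N \<le> w / \<sigma> + 1" by linarith+
    then have N: "w < real N * \<sigma>" "real N * \<sigma> \<le> w + \<sigma>" using \<sigma> by (simp_all add: field_simps)
    have wide: "real (N + 2) * \<sigma> \<le> w + min e1 e2"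
      using N(2) by (simp add: distrib_right \<sigma>_def)
    have "m - w - e1 \<in> S" "m + w + e2 \<in> S" using e1 e2 by (auto simp: subset_iff)
    then have "{m - w - e1..m + w + e2} \<subseteq> S"
      using closed_segment_subset[of "m - w - e1" S "m + w + e2"] S(2) w0 e1(1) e2(1)
      by (simp add: closed_segment_eq_real_ivl)
    then have sub: "{m - real (N + 2) * \<sigma>..m + real (N + 2) * \<sigma>} \<subseteq> S"
      using wide by (intro order.trans[OF _ \<open>{m - w - e1..m + w + e2} \<subseteq> S\<close>]) auto
    let ?U = "{m - real N * \<sigma><..<m + real N * \<sigma>}"
    obtain \<mu> c d where \<mu>: "sets \<mu> = sets borel" "levy_khinchin_rep ?U m \<psi> c d \<mu>"
      using local_levy_khinchin_rep[OF nd cont \<sigma> _ sub] by (auto simp: N_def)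
    have "m \<in> ?U" "t0 \<in> ?U" "t \<in> ?U" using N(1) w0 ends by (auto simp: min_def max_def split: if_splits)
    moreover from this obtain c' d' where "levy_khinchin_rep ?U t0 \<psi> c' d' \<mu>"
      using levy_khinchin_rep_change_base[OF \<mu>(1) open_greaterThanLessThan _ _ \<mu>(2)] by blast
    ultimately show ?thesis using \<mu>(1) open_greaterThanLessThan by blast
  qed
  obtain U \<mu> c d where U: "open U" "t0 \<in> U" and \<mu>: "sets \<mu> = sets borel" "levy_khinchin_rep U t0 \<psi> c d \<mu>"
    using nearby[OF S(3)] by blast
  have "levy_khinchin_rep S t0 \<psi> c d \<mu>"
  proof -
    have "\<exists>V. t \<in> V \<and> levy_khinchin_rep V t0 \<psi> c d \<mu>" if t: "t \<in> S" for t
    proof -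
      obtain V \<nu> c' d' where V: "open V" "t0 \<in> V" "t \<in> V"
        and \<nu>: "sets \<nu> = sets borel" "levy_khinchin_rep V t0 \<psi> c' d' \<nu>"
        using nearby[OF t] by blast
      have UV: "open (U \<inter> V)" "t0 \<in> U \<inter> V" using U V by auto
      have \<mu>': "levy_khinchin_rep (U \<inter> V) t0 \<psi> c d \<mu>" and \<nu>': "levy_khinchin_rep (U \<inter> V) t0 \<psi> c' d' \<nu>"
        using \<mu>(2) \<nu>(2) by (auto intro: levy_khinchin_rep_subset)
      have "c' = c"
        using levy_khinchin_rep_derivatives(1)[OF \<mu>(1) \<mu>' UV UV(2)]
          levy_khinchin_rep_derivatives(1)[OF \<nu>(1) \<nu>' UV UV(2)] by simp
      moreover have "d' = d"
        using levy_khinchin_rep_derivatives(2)[OF \<mu>(1) \<mu>' UV UV(2)]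
          levy_khinchin_rep_derivatives(2)[OF \<nu>(1) \<nu>' UV UV(2)] by (rule DERIV_unique[symmetric])
      moreover have "\<nu> = \<mu>"
      proof (rule laplace_uniqueness_open[OF \<nu>(1) \<mu>(1) UV])
        fix y assume y: "y \<in> U \<inter> V"
        show "integrable \<nu> (\<lambda>l. exp (- l * y))"
          by (rule levy_khinchin_integrable_exp[OF \<nu>(1) \<nu>' UV(1) y])
        show "integrable \<mu> (\<lambda>l. exp (- l * y))"
          by (rule levy_khinchin_integrable_exp[OF \<mu>(1) \<mu>' UV(1) y])
        show "(\<integral>l. exp (- l * y) \<partial>\<nu>) = (\<integral>l. exp (- l * y) \<partial>\<mu>)"
          using DERIV_unique[OF levy_khinchin_rep_derivatives(4)[OF \<mu>(1) \<mu>' UV y]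
              levy_khinchin_rep_derivatives(4)[OF \<nu>(1) \<nu>' UV y]] by simp
      qed
      ultimately show ?thesis using \<nu>(2) V(3) by blast
    qed
    then show ?thesis unfolding levy_khinchin_rep_def by blast
  qed
  then show ?thesis using \<mu>(1) by blast
qed

theorem theorem3p9:
  fixes a b :: ereal and t0 :: real
  assumes "a < b" and "t0 \<in> einterval a b"
  shows
    "(\<forall>\<psi> :: real \<Rightarrow> real.
        (continuous_on (einterval a b) \<psi> \<and> negative_definite_on (einterval a b) \<psi>) \<longleftrightarrow>
        (\<exists>(\<mu> :: real measure) c d.
           sets \<mu> = sets borel \<and> levy_khinchin_rep (einterval a b) t0 \<psi> c d \<mu>)) \<and>
     (\<forall>(\<psi> :: real \<Rightarrow> real) (\<mu> :: real measure) c d.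
        sets \<mu> = sets borel \<longrightarrow> levy_khinchin_rep (einterval a b) t0 \<psi> c d \<mu> \<longrightarrow>
          c = \<psi> t0 \<and>
          (\<psi> has_real_derivative d) (at t0) \<and>
          (\<forall>t\<in>einterval a b.
             \<psi> differentiable (at t) \<and> deriv \<psi> differentiable (at t) \<and>
             ereal (- deriv (deriv \<psi>) t) = enn2ereal (laplace_transform \<mu> t)) \<and>
          (\<forall>\<nu> :: real measure.
             sets \<nu> = sets borel \<longrightarrow>
             (\<forall>t\<in>einterval a b.
                ereal (- deriv (deriv \<psi>) t) = enn2ereal (laplace_transform \<nu> t)) \<longrightarrow>
             \<nu> = \<mu>)) \<and>
     (\<forall>\<mu> :: real measure. sets \<mu> = sets borel \<longrightarrow>
        ((\<exists>(\<psi> :: real \<Rightarrow> real) c d.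
            continuous_on (einterval a b) \<psi> \<and> negative_definite_on (einterval a b) \<psi> \<and>
            levy_khinchin_rep (einterval a b) t0 \<psi> c d \<mu>) \<longleftrightarrow>
         (\<forall>t\<in>einterval a b. laplace_transform \<mu> t < \<infinity>)))"
proof -
  let ?S = "einterval a b"
  have S: "open ?S" "t0 \<in> ?S" using assms by auto
  have convex: "convex ?S"
    unfolding is_interval_convex_1[symmetric] is_interval_1 einterval_def
    by auto (meson ereal_less_eq(3) le_less_trans less_le_trans)+
  have cont_nd: "continuous_on ?S \<psi> \<and> negative_definite_on ?S \<psi>"
    if "sets \<mu> = sets borel" "levy_khinchin_rep ?S t0 \<psi> c d \<mu>" for \<psi> \<mu> c d
    using levy_khinchin_rep_derivatives(3)[OF that S] levy_khinchin_rep_negative_definite[OF that(2) convex]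
    by (auto intro!: continuous_at_imp_continuous_on DERIV_isCont)
  have finite: "integrable \<mu> (\<lambda>l. exp (- l * t))"
    if "sets \<mu> = sets borel" "levy_khinchin_rep ?S t0 \<psi> c d \<mu>" "t \<in> ?S" for \<psi> \<mu> c d t
    using levy_khinchin_integrable_exp[OF that(1,2) S(1) that(3)] .
  have second: "ereal (- deriv (deriv \<psi>) t) = enn2ereal (laplace_transform \<mu> t)"
    if "sets \<mu> = sets borel" "levy_khinchin_rep ?S t0 \<psi> c d \<mu>" "t \<in> ?S" for \<psi> \<mu> c d t
    using DERIV_imp_deriv[OF levy_khinchin_rep_derivatives(4)[OF that(1,2) S that(3)]]
    by (simp add: laplace_transform_eq_integral[OF that(1) finite[OF that]])
  show ?thesis
  proof (intro conjI allI impI ballI iffI)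
    fix \<psi> assume "continuous_on ?S \<psi> \<and> negative_definite_on ?S \<psi>"
    then show "\<exists>\<mu> c d. sets \<mu> = sets borel \<and> levy_khinchin_rep ?S t0 \<psi> c d \<mu>"
      using negative_definite_imp_levy_khinchin_rep[OF S(1) convex S(2)] by blast
  next
    fix \<psi> assume "\<exists>\<mu> c d. sets \<mu> = sets borel \<and> levy_khinchin_rep ?S t0 \<psi> c d \<mu>"
    then show "continuous_on ?S \<psi>" "negative_definite_on ?S \<psi>" using cont_nd by blast+
  next
    fix \<psi> and \<mu> :: "real measure" and c d
    assume \<mu>: "sets \<mu> = sets borel" "levy_khinchin_rep ?S t0 \<psi> c d \<mu>"
    note D = levy_khinchin_rep_derivatives[OF \<mu> S]
    show "c = \<psi> t0" "(\<psi> has_real_derivative d) (at t0)" using D(1,2)[OF S(2)] by auto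
    show "\<psi> differentiable (at t)" "deriv \<psi> differentiable (at t)" if "t \<in> ?S" for t
      using D(3,4)[OF that] real_differentiable_def by blast+
    show "ereal (- deriv (deriv \<psi>) t) = enn2ereal (laplace_transform \<mu> t)" if "t \<in> ?S" for t
      by (rule second[OF \<mu> that])
    fix \<nu> :: "real measure"
    assume \<nu>: "sets \<nu> = sets borel"
      "\<forall>t\<in>?S. ereal (- deriv (deriv \<psi>) t) = enn2ereal (laplace_transform \<nu> t)"
    \<comment> \<open>Finiteness of the transform of \<open>\<nu>\<close> is inherited from
      \<open>\<mu>\<close> through the common value \<open>- deriv (deriv \<psi>) t\<close>; only
      then do the Bochner integrals below represent the transforms.\<close>
    have eq: "laplace_transform \<nu> t = laplace_transform \<mu> t" if "t \<in> ?S" for t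
      using \<nu>(2) second[OF \<mu> that] that by (metis enn2ereal_inject)
    have int: "integrable \<nu> (\<lambda>l. exp (- l * t))" if "t \<in> ?S" for t
      using eq[OF that] laplace_transform_finite_iff[OF \<nu>(1), of t]
        laplace_transform_finite_iff[OF \<mu>(1), of t] finite[OF \<mu> that] by simp
    show "\<nu> = \<mu>"
    proof (rule laplace_uniqueness_open[OF \<nu>(1) \<mu>(1) S int finite[OF \<mu>]])
      fix t assume t: "t \<in> ?S"
      show "(\<integral>l. exp (- l * t) \<partial>\<nu>) = (\<integral>l. exp (- l * t) \<partial>\<mu>)"
        using eq[OF t]
        unfolding laplace_transform_eq_integral[OF \<nu>(1) int[OF t]]
          laplace_transform_eq_integral[OF \<mu>(1) finite[OF \<mu> t]]
        by (subst (asm) ennreal_inj) (auto intro!: integral_nonneg_AE)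
    qed
  next
    fix \<mu> :: "real measure" and t
    assume "sets \<mu> = sets borel" "\<exists>\<psi> c d. continuous_on ?S \<psi> \<and> negative_definite_on ?S \<psi> \<and>
        levy_khinchin_rep ?S t0 \<psi> c d \<mu>" "t \<in> ?S"
    then show "laplace_transform \<mu> t < \<infinity>" using laplace_transform_finite_iff finite by blast
  next
    fix \<mu> :: "real measure"
    assume \<mu>: "sets \<mu> = sets borel" "\<forall>t\<in>?S. laplace_transform \<mu> t < \<infinity>"
    \<comment> \<open>The witness is the integral itself, with \<open>c = d = 0\<close>; finiteness
      at \<open>t0\<close> and at \<open>t\<close> makes the kernel integrable.\<close>
    have "levy_khinchin_rep ?S t0 (\<lambda>t. \<integral>l. efun t0 l t * exp (- l * t0) \<partial>\<mu>) 0 0 \<mu>"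
    proof -
      have "integrable \<mu> (\<lambda>l. efun t0 l t * exp (- l * t0))" if "t \<in> ?S" for t
        by (rule efun_integrable[OF \<mu>(1)])
           (use \<mu>(2) S(2) that in \<open>simp_all only: laplace_transform_finite_iff[OF \<mu>(1)]\<close>)
      then show ?thesis by (simp add: levy_khinchin_rep_def)
    qed
    then show "\<exists>\<psi> c d. continuous_on ?S \<psi> \<and> negative_definite_on ?S \<psi> \<and>
        levy_khinchin_rep ?S t0 \<psi> c d \<mu>"
      using cont_nd[OF \<mu>(1)] by blast
  qed
qed

end
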